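(* Let $\delta:\mathbb{N}\to\mathbb{R}_{\ge 0}$ be a function with $\delta(n)=o(n)$. Then there is a function $\varepsilon:\mathbb{N}\to\mathbb{R}_{\ge 0}$ with $\varepsilon(n)=o(n)$ such that for every $n$, every $\delta(n)$-random labeled graph $G$ on $n$ nodes, and every pair of distinct nodes $i,j$ of $G$, the number $r$ of disjoint paths of length 2 between $i$ and $j$ in $G$ satisfies $|r - n/4| \leq \varepsilon(n)$. In particular, for all sufficiently large $n$, every $\delta(n)$-random labeled graph on $n$ nodes has diameter 2.
   Context: Kolmogorov complexity: natural numbers are identified with finite binary strings via $(0,\epsilon),(1,0),(2,1),(3,00),(4,01),\ldots$; $l(x)$ is the length of the string $x$. Let $T_0,T_1,\ldots$ be a standard enumeration of all Turing machines, $\langle\cdot,\cdot\rangle$ a standard one-one pairing $\mathbb{N}\times\mathbb{N}\to\mathbb{N}$ with $l(\langle x,y\rangle)=l(y)+O(l(x))$ (e.g. $\langle x,y\rangle = 1^{l(x)}0xy$), and $U$ a fixed universal Turing machine with $U(\langle\langle i,p\rangle,y\rangle)=T_i(\langle p,y\rangle)$ for all $i,p,y$. The conditional Kolmogorov complexity is $C(x\mid y)=\min\{l(p): p\in\{0,1\}^*,\ U(\langle p,y\rangle)=x\}$. Graph encoding: graphs are simple and undirected. A labeled graph $G$ on nodes $\{1,\dots,n\}$ is identified with the binary string $E(G)$ of length $\binom{n}{2}$ whose $i$th bit is 1 if the $i$th possible edge (in a fixed order, e.g. lexicographic) is present and 0 otherwise. The graph $G$ is $\delta(n)$-random (has randomness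 deficiency at most $\delta(n)$) if $C(E(G)\mid n)\geq \binom{n}{2}-\delta(n)$. Paths between $i$ and $j$ are disjoint if they share no nodes other than $i$ and $j$; the number of disjoint paths of length 2 between $i$ and $j$ is the number of nodes $k\neq i,j$ adjacent to both $i$ and $j$. "$o(n)$-random" graphs means $\delta(n)$-random graphs for a function $\delta(n)=o(n)$. *)

theory Defs
  imports Complex_Main "HOL-Library.Landau_Symbols" "HOL-Library.While_Combinator"
    "HOL-Library.Extended_Nat"
begin

section \<open>Binary strings\<close>

text \<open>
  Strings are boolean lists (\<open>False\<close> is the digit 0, \<open>True\<close> the digit 1).  The identification of
  natural numbers with strings is the length-increasing lexicographic one,
  \<open>(0,\<epsilon>), (1,0), (2,1), (3,00), (4,01), \<dots>\<close>.
\<close>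

fun string_of_nat :: "nat \<Rightarrow> bool list" where
  "string_of_nat 0 = []"
| "string_of_nat (Suc m) = string_of_nat (m div 2) @ [odd m]"

lemma string_of_nat_upto_6:
  "map string_of_nat [0..<7] =
    [[], [False], [True], [False, False], [False, True], [True, False], [True, True]]"
  by code_simp

lemma bij_string_of_nat: "bij string_of_nat"
proof (rule bijI)
  have "string_of_nat a = string_of_nat b \<Longrightarrow> a = b" for a b
  proof (induction a arbitrary: b rule: string_of_nat.induct)
    case 1
    then show ?case by (cases b) auto
  next
    case (2 m)
    then obtain k where b: "b = Suc k" by (cases b) auto
    with 2 have "m div 2 = k div 2" "odd m = odd k" by auto
    then have "m = k" by (metis even_iff_mod_2_eq_zero mod_mult_div_eq not_mod_2_eq_0_eq_1)
    with b show ?case by simp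
  qed
  then show "inj string_of_nat" by (rule injI)
next
  have "\<exists>a. string_of_nat a = w" for w
  proof (induction w rule: rev_induct)
    case Nil
    show ?case by (rule exI[of _ 0]) simp
  next
    case (snoc b w)
    then obtain a where "string_of_nat a = w" by blast
    then have "string_of_nat (Suc (2 * a + of_bool b)) = w @ [b]" by simp
    then show ?case by blast
  qed
  then show "surj string_of_nat" by (metis surjI)
qed

text \<open>The pairing \<open>\<langle>x,y\<rangle> = 1\<^sup>l\<^sup>(\<^sup>x\<^sup>) 0 x y\<close>.\<close>

definition string_pair :: "bool list \<Rightarrow> bool list \<Rightarrow> bool list" where
  "string_pair x y = replicate (length x) True @ [False] @ x @ y"


section \<open>Turing machines\<close>

text \<open>
  Deterministic machines with one two-way infinite tape.  A program is a finite table of rules,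
  sending the current state and scanned symbol to the symbol to be written, the head movement and
  the next state; if several rules apply, the first one counts.  The start state is \<open>0\<close>, and the
  machine halts when no rule applies.  \<open>Work m\<close> are auxiliary tape symbols, of which any given
  program can mention only finitely many.
\<close>

datatype tape_symbol = Blank | Bit bool | Work nat

datatype head_move = Move_Left | Move_Right | No_Move

type_synonym tm = "((nat \<times> tape_symbol) \<times> (tape_symbol \<times> head_move \<times> nat)) list"

type_synonym tm_config = "nat \<times> int \<times> (int \<Rightarrow> tape_symbol)"

fun move_head :: "head_move \<Rightarrow> int \<Rightarrow> int" where
  "move_head Move_Left h = h - 1"
| "move_head Move_Right h = h + 1"
| "move_head No_Move h = h"

fun tm_step :: "tm \<Rightarrow> tm_config \<Rightarrow> tm_config option" where
  "tm_step M (q, h, t) =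
    (case map_of M (q, t h) of
       None \<Rightarrow> None
     | Some (s, d, q') \<Rightarrow> Some (q', move_head d h, t(h := s)))"

definition tm_init :: "bool list \<Rightarrow> tm_config" where
  "tm_init w =
    (0, 0, \<lambda>z. if 0 \<le> z \<and> z < int (length w) then Bit (w ! nat z) else Blank)"

text \<open>
  The output is the longest block of bits that starts at the head position and extends to the right.
  It is finite because only finitely many cells of a reachable tape are nonblank.
\<close>

fun tm_output :: "tm_config \<Rightarrow> bool list" where
  "tm_output (q, h, t) =
    map (\<lambda>k. t (h + int k) = Bit True) [0..<(LEAST k. t (h + int k) \<notin> range Bit)]"

definition tm_fun :: "tm \<Rightarrow> bool list \<Rightarrow> bool list option" where
  "tm_fun M w =
    map_option tm_output
      (while_option (\<lambda>c. tm_step M c \<noteq> None) (\<lambda>c. the (tm_step M c)) (tm_init w))"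

text \<open>
  \<open>T\<close> lists all Turing machines and \<open>U\<close> is a Turing machine that is universal for this list.
  No particular program code is singled out; since \<open>U\<close> is itself a machine, the
  function \<open>(i, p, y) \<mapsto> T\<^sub>i(\<langle>p,y\<rangle>)\<close> is necessarily computable, i.e. \<open>T\<close> is effective.
\<close>

definition universal_tm :: "(nat \<Rightarrow> tm) \<Rightarrow> tm \<Rightarrow> bool" where
  "universal_tm T U \<longleftrightarrow>
    surj T \<and>
    (\<forall>i p y. tm_fun U (string_pair (string_pair (string_of_nat i) p) y) =
             tm_fun (T i) (string_pair p y))"


section \<open>Conditional Kolmogorov complexity\<close>

text \<open>For universal \<open>U\<close> every \<open>x\<close> has a program given \<open>y\<close>, so the minimum is taken over a
  nonempty set.\<close>

definition kolmogorov :: "tm \<Rightarrow> bool list \<Rightarrow> bool list \<Rightarrow> nat" where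
  "kolmogorov U x y = (LEAST l. \<exists>p. l = length p \<and> tm_fun U (string_pair p y) = Some x)"


section \<open>Labeled graphs\<close>

text \<open>A simple undirected graph on the nodes \<open>{1..n}\<close> is given by its set of edges, which are
  two-element sets of nodes.\<close>

definition labeled_graph :: "nat \<Rightarrow> nat set set \<Rightarrow> bool" where
  "labeled_graph n E \<longleftrightarrow> E \<subseteq> {e. e \<subseteq> {1..n} \<and> card e = 2}"

definition possible_edges :: "nat \<Rightarrow> (nat \<times> nat) list" where
  "possible_edges n = [(i, j). i \<leftarrow> [1..<Suc n], j \<leftarrow> [Suc i..<Suc n]]"

definition graph_string :: "nat \<Rightarrow> nat set set \<Rightarrow> bool list" where
  "graph_string n E = map (\<lambda>(i, j). {i, j} \<in> E) (possible_edges n)"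

lemma length_graph_string: "length (graph_string n E) = n choose 2"
proof -
  have "length (graph_string n E) = (\<Sum>i\<leftarrow>[1..<Suc n]. n - i)"
    by (simp add: graph_string_def possible_edges_def length_concat o_def del: upt_Suc)
  also have "\<dots> = (\<Sum>i=1..<Suc n. n - i)"
    by (simp only: interv_sum_list_conv_sum_set_nat set_upt)
  also have "\<dots> = (\<Sum>i=0..<n. i)"
    by (rule sum.reindex_bij_witness[of _ "\<lambda>i. n - i" "\<lambda>i. n - i"]) auto
  also have "\<dots> = n choose 2"
    by (induction n) (auto simp: numeral_2_eq_2)
  finally show ?thesis .
qed

definition random_graph :: "tm \<Rightarrow> real \<Rightarrow> nat \<Rightarrow> nat set set \<Rightarrow> bool" where
  "random_graph U d n E \<longleftrightarrow>
    labeled_graph n E \<and>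
    real (kolmogorov U (graph_string n E) (string_of_nat n)) \<ge> real (n choose 2) - d"

definition num_two_paths :: "nat \<Rightarrow> nat set set \<Rightarrow> nat \<Rightarrow> nat \<Rightarrow> nat" where
  "num_two_paths n E i j =
    card {k \<in> {1..n}. k \<noteq> i \<and> k \<noteq> j \<and> {i, k} \<in> E \<and> {k, j} \<in> E}"

definition graph_path :: "nat set set \<Rightarrow> nat \<Rightarrow> nat list \<Rightarrow> nat \<Rightarrow> bool" where
  "graph_path E u p v \<longleftrightarrow>
    p \<noteq> [] \<and> hd p = u \<and> last p = v \<and> distinct p \<and> successively (\<lambda>a b. {a, b} \<in> E) p"

text \<open>Distance and diameter are \<open>\<infinity>\<close> if there is no connecting path.\<close>

definition graph_dist :: "nat set set \<Rightarrow> nat \<Rightarrow> nat \<Rightarrow> enat" where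
  "graph_dist E u v = (INF p \<in> {p. graph_path E u p v}. enat (length p - 1))"

definition graph_diameter :: "nat \<Rightarrow> nat set set \<Rightarrow> enat" where
  "graph_diameter n E = (SUP u \<in> {1..n}. SUP v \<in> {1..n}. graph_dist E u v)"

end

theory Submission
  imports Defs "HOL-Library.Countable" "HOL-Library.Nat_Bijection"
begin

text \<open>
The argument is a compression by enumeration.  Fix \<open>m \<ge> 2\<close> and call a graph deviant if
some two of its nodes have a number of common neighbours that differs from \<open>n/4\<close> by at least
\<open>n/m\<close>.  In a uniformly distributed graph the common neighbours of two fixed nodes are counted by
\<open>n - 2\<close> independent events of probability \<open>1/4\<close>, so an exponential moment
(\<open>two_path_moment\<close>) shows that at most \<open>2 n\<^sup>2 2\<^sup>N exp (1 - n/m\<^sup>2)\<close> of the \<open>2\<^sup>N\<close> graphs are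
deviant, where \<open>N = n choose 2\<close> (\<open>card_deviant_le\<close>).  Deviance is decidable; hence a machine
that knows \<open>n\<close> can list the deviant graphs and recover each of them from its rank in the list.
The rank has only \<open>N - n/(m\<^sup>2 ln 2) + O(log n)\<close> bits, which bounds the complexity of a deviant
graph (\<open>kolmogorov_deviant_le\<close>).  As \<open>\<delta>(n) = o(n)\<close>, this is less than \<open>N - \<delta>(n)\<close> for all large
\<open>n\<close>, so no \<open>\<delta>(n)\<close>-random graph is deviant then (\<open>eventually_not_deviant\<close>).  Since \<open>m\<close> is arbitrary,
the largest deviation that occurs in a \<open>\<delta>(n)\<close>-random graph is \<open>o(n)\<close>.

For \<open>m = 5\<close> the number of common neighbours of two nodes lies strictly between \<open>n/20\<close> and
\<open>9n/20\<close>.  It is positive, so distances are at most 2; and it is less than \<open>n - 2\<close>, the value in a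
complete graph, so some distance is at least 2.

The listing machine has to be an actual rule table.  It is obtained in two steps.  Programs for a
machine with counting registers are translated to Turing machines (\<open>program_to_tm\<close>).  The
functions that such programs compute are closed under primitive recursion
(\<open>computable_rec_nat\<close>), so machines need no further construction once a function is written
with sums, products, powers and bounded quantifiers (\<open>computable_to_tm\<close>).  Running time is
irrelevant, hence the decoder may search through all numbers.  The compression itself does not
depend on graphs and is stated for arbitrary decidable families (\<open>kolmogorov_enumerated\<close>).
\<close>

section \<open>Register programs\<close>

text \<open>
Registers hold natural numbers; the input is a bit string with random access, and the output is a
bit string that grows at its front.  Both conventions are dictated by the translation to Turing
machines: the input stays on the nonnegative half of the tape, and the output is written to the
left of it.  \<open>Read r q\<close> adds to register \<open>q\<close> the digit of the input at the position held in \<open>r\<close>.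
\<close>

datatype instr = Inc nat | Dec nat | While nat "instr list" | Read nat nat | Emit nat

instance instr :: countable by countable_datatype

text \<open>
The digits are those of bijective base 2, in which numbers correspond to strings; the digit 0
signals the end of the input.
\<close>

definition input_digit :: "bool list \<Rightarrow> nat \<Rightarrow> nat" where
  "input_digit w z = (if z < length w then (if w ! z then 2 else 1) else 0)"

type_synonym prog_config = "instr list \<times> (nat \<Rightarrow> nat) \<times> bool list"

text \<open>
A configuration consists of the instructions that remain to be executed, the registers and the
output.  With continuations in place of a program counter, programs can be concatenated without
relocating jump targets.
\<close>

inductive prog_step :: "bool list \<Rightarrow> prog_config \<Rightarrow> prog_config \<Rightarrow> bool" for w where
  Inc: "prog_step w (Inc r # k, s, out) (k, s(r := Suc (s r)), out)"
| Dec: "prog_step w (Dec r # k, s, out) (k, s(r := s r - 1), out)"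
| While: "prog_step w (While r c # k, s, out) (if s r = 0 then k else c @ While r c # k, s, out)"
| Read: "prog_step w (Read r q # k, s, out) (replicate (input_digit w (s r)) (Inc q) @ k, s, out)"
| Emit: "prog_step w (Emit r # k, s, out) (k, s, (s r \<noteq> 0) # out)"

fun succs :: "instr list \<Rightarrow> instr list set" where
  "succs [] = {}"
| "succs (Inc r # k) = {k}"
| "succs (Dec r # k) = {k}"
| "succs (While r c # k) = {k, c @ While r c # k}"
| "succs (Read r q # k) = {k, Inc q # k, Inc q # Inc q # k}"
| "succs (Emit r # k) = {k}"

text \<open>
Only finitely many continuations are reachable from a program, and these become the states of the
Turing machine.  \<open>conts c k\<close> collects those met while \<open>c\<close> is executed in front of \<open>k\<close>.  A \<open>Read\<close>
passes through the increments by which it is carried out.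
\<close>

fun conts :: "instr list \<Rightarrow> instr list \<Rightarrow> instr list set" where
  "conts [] k = {k}"
| "conts (While r b # c) k =
     insert (While r b # c @ k) (conts b (While r b # c @ k) \<union> conts c k)"
| "conts (Read r q # c) k =
     {Read r q # c @ k, Inc q # c @ k, Inc q # Inc q # c @ k} \<union> conts c k"
| "conts (i # c) k = insert (i # c @ k) (conts c k)"

lemma finite_conts: "finite (conts c k)"
  by (induction c k rule: conts.induct) auto

lemma conts_entry: "c @ k \<in> conts c k"
  by (induction c k rule: conts.induct) auto

lemma conts_closed: "x \<in> conts c k \<Longrightarrow> y \<in> succs x \<Longrightarrow> y \<in> conts c k \<or> x = k"
proof (induction c k rule: conts.induct)
  case (2 r b c k)
  then show ?case using conts_entry[of c k] conts_entry[of b "While r b # c @ k"] by auto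
qed (auto simp: conts_entry)

lemma prog_step_succs: "prog_step w (c, s, out) (c', s', out') \<Longrightarrow> c' \<in> succs c"
  by (auto elim!: prog_step.cases simp: input_digit_def numeral_2_eq_2)


section \<open>Simulation by Turing machines\<close>

text \<open>
A tape symbol is read as a finite set of marks: 0 marks the home cell, 1 and 2 stand for an input
bit, and \<open>r + 3\<close> is a mark of register \<open>r\<close>.  The register value is kept in unary, as the number of
marked cells counted from the home cell.  Blank cells and input cells are legitimate mark sets, so
that the tape need not be recoded before the simulation starts.
\<close>

fun cell :: "tape_symbol \<Rightarrow> nat set" where
  "cell Blank = {}"
| "cell (Bit b) = {if b then 1 else 2}"
| "cell (Work m) = set_decode m"

definition cell_symbol :: "nat set \<Rightarrow> tape_symbol" where
  "cell_symbol D = Work (set_encode D)"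

lemma cell_cell_symbol [simp]: "finite D \<Longrightarrow> cell (cell_symbol D) = D"
  by (simp add: cell_symbol_def)

lemma finite_cell [simp]: "finite (cell y)"
  by (cases y) auto

definition symbols :: "nat \<Rightarrow> tape_symbol set" where
  "symbols K = {Blank, Bit True, Bit False} \<union> cell_symbol ` Pow {..<K + 3}"

lemma finite_symbols [simp]: "finite (symbols K)"
  by (simp add: symbols_def)

lemma Bit_in_symbols [simp]: "Bit b \<in> symbols K"
  by (cases b) (auto simp: symbols_def)

lemma Blank_in_symbols [simp]: "Blank \<in> symbols K"
  by (simp add: symbols_def)

lemma cell_subset: "y \<in> symbols K \<Longrightarrow> cell y \<subseteq> {..<K + 3}"
proof -
  have "finite D" if "D \<subseteq> {..<K + 3}" for D
    using that finite_subset by blast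
  then show "y \<in> symbols K \<Longrightarrow> cell y \<subseteq> {..<K + 3}"
    by (force simp: symbols_def)
qed

lemma cell_symbol_in_symbols: "D \<subseteq> {..<K + 3} \<Longrightarrow> cell_symbol D \<in> symbols K"
  by (auto simp: symbols_def)

text \<open>
In phase \<open>Home\<close> the next instruction is started at the home cell, and the head possibly walks to the
end of a register; \<open>Return\<close> walks back from the right.  \<open>Write\<close> walks left to the end of the output
and \<open>Forward\<close> returns from there.  \<open>Finish\<close> moves the head to the first output bit when the
program is done.
\<close>

datatype phase = Home | Return | Erase | Write bool | Forward | Finish | Stop

instance phase :: countable by countable_datatype

lemma UNIV_phase: "UNIV = {Home, Return, Erase, Write True, Write False, Forward, Finish, Stop}"
proof -
  have "ph \<in> {Home, Return, Erase, Write True, Write False, Forward, Finish, Stop}" for ph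
    by (cases ph) auto
  then show ?thesis by blast
qed

definition state :: "instr list \<Rightarrow> phase \<Rightarrow> nat" where
  "state c ph = Suc (to_nat (c, ph))"

definition cell_digit :: "tape_symbol \<Rightarrow> nat" where
  "cell_digit y = (if 1 \<in> cell y then 2 else if 2 \<in> cell y then 1 else 0)"

fun act :: "instr list \<Rightarrow> phase \<Rightarrow> tape_symbol \<Rightarrow>
    (tape_symbol \<times> head_move \<times> instr list \<times> phase) option" where
  "act [] Home y = Some (y, Move_Left, [], Finish)"
| "act (Inc r # k) Home y =
     (if r + 3 \<in> cell y then Some (y, Move_Right, Inc r # k, Home)
      else Some (cell_symbol (insert (r + 3) (cell y)), No_Move, k, Return))"
| "act (Dec r # k) Home y =
     (if r + 3 \<in> cell y then Some (y, Move_Right, Dec r # k, Home)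
      else if 0 \<in> cell y then Some (y, No_Move, k, Home)
      else Some (y, Move_Left, Dec r # k, Erase))"
| "act (While r c # k) Home y =
     Some (y, No_Move, if r + 3 \<in> cell y then c @ While r c # k else k, Home)"
| "act (Read r q # k) Home y =
     (if r + 3 \<in> cell y then Some (y, Move_Right, Read r q # k, Home)
      else Some (y, No_Move, replicate (cell_digit y) (Inc q) @ k, Return))"
| "act (Emit r # k) Home y = Some (y, Move_Left, k, Write (r + 3 \<in> cell y))"
| "act c Return y =
     (if 0 \<in> cell y then Some (y, No_Move, c, Home) else Some (y, Move_Left, c, Return))"
| "act (Dec r # k) Erase y = Some (cell_symbol (cell y - {r + 3}), No_Move, k, Return)"
| "act c (Write b) y =
     (if y = Blank then Some (Bit b, Move_Right, c, Forward) else Some (y, Move_Left, c, Write b))"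
| "act c Forward y =
     (if 0 \<in> cell y then Some (y, No_Move, c, Home) else Some (y, Move_Right, c, Forward))"
| "act c Finish y =
     (if y = Blank then Some (y, Move_Right, c, Stop) else Some (y, Move_Left, c, Finish))"
| "act _ _ _ = None"

text \<open>
State 0 is the start state of every machine; it puts the home mark on the first cell.
\<close>

definition transition ::
    "instr list \<Rightarrow> instr list set \<Rightarrow> nat \<Rightarrow> nat \<times> tape_symbol \<Rightarrow> (tape_symbol \<times> head_move \<times> nat) option" where
  "transition p C K = (\<lambda>(q, y).
     case q of
       0 \<Rightarrow> Some (cell_symbol (insert 0 (cell y)), No_Move, state p Home)
     | Suc n \<Rightarrow> (case from_nat n of (c, ph) \<Rightarrow>
         map_option (\<lambda>(y', d, c', ph'). (y', d, state c' ph')) (act c ph y)))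
     |` (insert 0 ((\<lambda>(c, ph). state c ph) ` (C \<times> UNIV)) \<times> symbols K)"

lemma transition_start:
  "y \<in> symbols K \<Longrightarrow> transition p C K (0, y) = Some (cell_symbol (insert 0 (cell y)), No_Move, state p Home)"
  by (simp add: transition_def)

lemma transition_state:
  assumes "y \<in> symbols K" "c \<in> C"
  shows "transition p C K (state c ph, y) =
    map_option (\<lambda>(y', d, c', ph'). (y', d, state c' ph')) (act c ph y)"
proof -
  have "(state c ph, y) \<in> insert 0 ((\<lambda>(c, ph). state c ph) ` (C \<times> UNIV)) \<times> symbols K"
    using assms by (auto intro!: image_eqI[of _ _ "(c, ph)"])
  then show ?thesis
    unfolding transition_def by (simp only: restrict_in) (simp add: state_def)
qed

lemma finite_dom_transition:
  assumes "finite C"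
  shows "finite (dom (transition p C K))"
proof -
  have "finite (insert 0 ((\<lambda>(c, ph). state c ph) ` (C \<times> UNIV)) \<times> symbols K)"
    using assms by (simp add: UNIV_phase)
  then show ?thesis
    unfolding transition_def dom_restrict by (rule finite_Int[OF disjI2])
qed

lemma ex_table: "finite (dom m) \<Longrightarrow> \<exists>M. map_of M = m"
  by (metis finite_list map_of_map_keys)


declare tm_step.simps [simp del]

abbreviation tm_steps :: "tm \<Rightarrow> tm_config \<Rightarrow> tm_config \<Rightarrow> bool" where
  "tm_steps M \<equiv> (\<lambda>a b. tm_step M a = Some b)\<^sup>*\<^sup>*"

lemma tm_fun_steps:
  assumes "tm_steps M (tm_init w) c" "tm_step M c = None"
  shows "tm_fun M w = Some (tm_output c)"
proof -
  have "while_option (\<lambda>c. tm_step M c \<noteq> None) (\<lambda>c. the (tm_step M c)) a = Some c"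
    if "tm_steps M a c" for a
    using that
  proof (induction rule: converse_rtranclp_induct)
    case base
    then show ?case using assms(2) by (subst while_option_unfold) simp
  next
    case (step y z)
    then show ?case by (subst while_option_unfold) simp
  qed
  then show ?thesis using assms(1) by (simp add: tm_fun_def)
qed

lemma walk_right:
  assumes "\<And>z. a \<le> z \<Longrightarrow> z < a + int n \<Longrightarrow> tm_step M (q, z, t) = Some (q, z + 1, t)"
  shows "tm_steps M (q, a, t) (q, a + int n, t)"
  using assms
proof (induction n)
  case (Suc n)
  have "tm_steps M (q, a, t) (q, a + int n, t)" by (rule Suc.IH) (auto intro: Suc.prems)
  also have "tm_step M (q, a + int n, t) = Some (q, a + int (Suc n), t)"
    using Suc.prems[of "a + int n"] by (simp add: algebra_simps)
  finally show ?case .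
qed simp

lemma walk_left:
  assumes "\<And>z. a - int n < z \<Longrightarrow> z \<le> a \<Longrightarrow> tm_step M (q, z, t) = Some (q, z - 1, t)"
  shows "tm_steps M (q, a, t) (q, a - int n, t)"
  using assms
proof (induction n)
  case (Suc n)
  have "tm_steps M (q, a, t) (q, a - int n, t)" by (rule Suc.IH) (auto intro: Suc.prems)
  also have "tm_step M (q, a - int n, t) = Some (q, a - int (Suc n), t)"
    using Suc.prems[of "a - int n"] by (simp add: algebra_simps)
  finally show ?case .
qed simp

text \<open>
The last conjunct concerns the output, which occupies the cells immediately left of the home cell
as plain bits: there it ends properly, since the home cell is never a plain bit.
\<close>

definition tape_rep :: "nat \<Rightarrow> bool list \<Rightarrow> (nat \<Rightarrow> nat) \<Rightarrow> bool list \<Rightarrow> (int \<Rightarrow> tape_symbol) \<Rightarrow> bool" where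
  "tape_rep K w s out t \<longleftrightarrow>
     (\<forall>z. t z \<in> symbols K) \<and>
     (\<forall>z. 0 \<in> cell (t (int z)) \<longleftrightarrow> z = 0) \<and>
     (\<forall>z. cell_digit (t (int z)) = input_digit w z) \<and>
     (\<forall>z r. r + 3 \<in> cell (t (int z)) \<longleftrightarrow> z < s r) \<and>
     (\<forall>z. t (- int (Suc z)) = (if z < length out then Bit (out ! (length out - Suc z)) else Blank))"

text \<open>
The marks that occur on the tape belong to registers at the head of a reachable continuation.  They
therefore have a common bound, which makes the tape alphabet of the rule table finite.
\<close>

fun head_register :: "instr list \<Rightarrow> nat" where
  "head_register [] = 0"
| "head_register (Inc r # _) = r"
| "head_register (Dec r # _) = r"
| "head_register (While r _ # _) = r"
| "head_register (Read r _ # _) = r"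
| "head_register (Emit r # _) = r"

locale compiled =
  fixes p :: "instr list" and C :: "instr list set" and K :: nat and M :: tm
  assumes table: "map_of M = transition p C K"
    and registers: "\<And>c. c \<in> C \<Longrightarrow> head_register c < K"
    and closed: "\<And>c d. c \<in> C \<Longrightarrow> d \<in> succs c \<Longrightarrow> d \<in> C"
begin

lemma step_state:
  assumes "t h \<in> symbols K" "c \<in> C"
  shows "tm_step M (state c ph, h, t) =
    map_option (\<lambda>(y, d, c', ph'). (state c' ph', move_head d h, t(h := y))) (act c ph (t h))"
  using assms by (auto simp: tm_step.simps table transition_state split: option.split)

lemma step_start:
  assumes "t h \<in> symbols K"
  shows "tm_step M (0, h, t) = Some (state p Home, h, t(h := cell_symbol (insert 0 (cell (t h)))))"
  using assms by (simp add: tm_step.simps table transition_start)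

lemma steps_return:
  assumes rep: "tape_rep K w s out t" and c: "c \<in> C"
  shows "tm_steps M (state c Return, int z, t) (state c Home, 0, t)"
proof -
  have sym: "t z \<in> symbols K" for z using rep by (simp add: tape_rep_def)
  have home: "0 \<in> cell (t (int z)) \<longleftrightarrow> z = 0" for z using rep by (simp add: tape_rep_def)
  have "tm_steps M (state c Return, int z, t) (state c Return, int z - int z, t)"
  proof (rule walk_left)
    fix x :: int assume "int z - int z < x" "x \<le> int z"
    then have "0 \<notin> cell (t x)" using home[of "nat x"] by simp
    then show "tm_step M (state c Return, x, t) = Some (state c Return, x - 1, t)"
      by (simp add: step_state sym c)
  qed
  also have "tm_step M (state c Return, int z - int z, t) = Some (state c Home, 0, t)"
    using home[of 0] by (simp add: step_state sym c)
  finally show ?thesis .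
qed

lemma steps_to_register_end:
  assumes rep: "tape_rep K w s out t" and c: "c \<in> C"
    and walk: "\<And>y. r + 3 \<in> cell y \<Longrightarrow> act c Home y = Some (y, Move_Right, c, Home)"
  shows "tm_steps M (state c Home, 0, t) (state c Home, int (s r), t)"
proof -
  have sym: "t z \<in> symbols K" for z using rep by (simp add: tape_rep_def)
  have "tm_steps M (state c Home, 0, t) (state c Home, 0 + int (s r), t)"
  proof (rule walk_right)
    fix x :: int assume x: "0 \<le> x" "x < 0 + int (s r)"
    then have "nat x < s r" by linarith
    then have "r + 3 \<in> cell (t (int (nat x)))" using rep unfolding tape_rep_def by blast
    then have "r + 3 \<in> cell (t x)" using x by simp
    then show "tm_step M (state c Home, x, t) = Some (state c Home, x + 1, t)"
      by (simp add: step_state sym c walk)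
  qed
  then show ?thesis by simp
qed

text \<open>
Increment and decrement change the unary representation in a single cell, the first unmarked or the
last marked one.  The hypothesis on \<open>v\<close> says that setting the mark of that cell as in \<open>D\<close> produces
exactly the marks of the new value.
\<close>

lemma tape_rep_update_register:
  assumes rep: "tape_rep K w s out t" and r: "r < K"
    and mem: "\<And>a. a \<noteq> r + 3 \<Longrightarrow> a \<in> D \<longleftrightarrow> a \<in> cell (t (int z))" and fin: "finite D"
    and val: "\<And>x. x < v \<longleftrightarrow> (if x = z then r + 3 \<in> D else x < s r)"
  shows "tape_rep K w (s(r := v)) out (t(int z := cell_symbol D))"
proof -
  have sym: "t z \<in> symbols K" for z using rep by (simp add: tape_rep_def)
  have D: "D \<subseteq> {..<K + 3}"
  proof
    fix a assume "a \<in> D"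
    then show "a \<in> {..<K + 3}" using mem[of a] r cell_subset[OF sym, of "int z"] by (cases "a = r + 3") auto
  qed
  have neg: "- int (Suc x) \<noteq> int z" for x by simp
  have home: "(0 \<in> D) = (0 \<in> cell (t (int z)))" using mem[of 0] by simp
  have digit: "cell_digit (cell_symbol D) = cell_digit (t (int z))"
    using mem[of 1] mem[of 2] fin by (simp add: cell_digit_def)
  have reg: "(q + 3 \<in> D) = (if q = r then z < v else q + 3 \<in> cell (t (int z)))" for q
    using mem[of "q + 3"] val[of z] by simp
  have val': "x < v \<longleftrightarrow> x < s r" if "x \<noteq> z" for x
    using val[of x] that by simp
  show ?thesis
    unfolding tape_rep_def
  proof (intro conjI allI)
    show "(t(int z := cell_symbol D)) x \<in> symbols K" for x
      using sym cell_symbol_in_symbols[OF D] by simp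
    show "(0 \<in> cell ((t(int z := cell_symbol D)) (int x))) = (x = 0)" for x
      using rep home fin by (auto simp: tape_rep_def)
    show "cell_digit ((t(int z := cell_symbol D)) (int x)) = input_digit w x" for x
      using rep digit by (auto simp: tape_rep_def)
    show "(q + 3 \<in> cell ((t(int z := cell_symbol D)) (int x))) = (x < (s(r := v)) q)" for x q
      using rep reg[of q] fin val'[of x] by (auto simp: tape_rep_def)
    show "(t(int z := cell_symbol D)) (- int (Suc x)) =
        (if x < length out then Bit (out ! (length out - Suc x)) else Blank)" for x
      using rep neg[of x] unfolding tape_rep_def by (metis fun_upd_other)
  qed
qed

lemma simulate_step:
  assumes step: "prog_step w (c, s, out) (c', s', out')"
    and rep: "tape_rep K w s out t" and c: "c \<in> C"
  shows "\<exists>t'. tape_rep K w s' out' t' \<and> tm_steps M (state c Home, 0, t) (state c' Home, 0, t')"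
proof -
  have sym: "t z \<in> symbols K" for z using rep by (simp add: tape_rep_def)
  have home: "0 \<in> cell (t (int z)) \<longleftrightarrow> z = 0" for z using rep by (simp add: tape_rep_def)
  have reg: "r + 3 \<in> cell (t (int z)) \<longleftrightarrow> z < s r" for z r using rep by (simp add: tape_rep_def)
  have digit: "cell_digit (t (int z)) = input_digit w z" for z using rep by (simp add: tape_rep_def)
  have c': "c' \<in> C" using step c closed prog_step_succs by blast
  note do = step_state[OF sym] 
  show ?thesis
    using step
  proof cases
    case (Inc r)
    have r: "r < K" using registers[OF c] Inc by simp
    let ?t = "t(int (s r) := cell_symbol (insert (r + 3) (cell (t (int (s r))))))"
    have rep': "tape_rep K w s' out' ?t"
      unfolding Inc by (rule tape_rep_update_register[OF rep r]) auto
    have "tm_steps M (state c Home, 0, t) (state c Home, int (s r), t)"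
      by (rule steps_to_register_end[OF rep c]) (simp add: Inc)
    also have "tm_step M (state c Home, int (s r), t) = Some (state c' Return, int (s r), ?t)"
      using c by (simp add: do reg Inc)
    also have "tm_steps M (state c' Return, int (s r), ?t) (state c' Home, 0, ?t)"
      by (rule steps_return[OF rep' c'])
    finally show ?thesis using rep' by blast
  next
    case (Dec r)
    have r: "r < K" using registers[OF c] Dec by simp
    have walk: "tm_steps M (state c Home, 0, t) (state c Home, int (s r), t)"
      by (rule steps_to_register_end[OF rep c]) (simp add: Dec)
    show ?thesis
    \<comment> \<open>At value 0 the head is still on the home cell, which has no marked cell to its left.\<close>
    proof (cases "s r")
      case 0
      note walk
      also have "tm_step M (state c Home, int (s r), t) = Some (state c' Home, 0, t)"
        using c 0 home[of 0] reg[of r 0] by (simp add: do Dec)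
      finally show ?thesis using rep 0 unfolding Dec by (auto simp: fun_upd_idem)
    next
      case (Suc v)
      let ?t = "t(int v := cell_symbol (cell (t (int v)) - {r + 3}))"
      have rep': "tape_rep K w s' out' ?t"
        unfolding Dec by (rule tape_rep_update_register[OF rep r]) (auto simp: Suc)
      note walk
      also have "tm_step M (state c Home, int (s r), t) = Some (state c Erase, int v, t)"
        using c Suc home[of "s r"] reg[of r "s r"] by (simp add: do Dec)
      also have "tm_step M (state c Erase, int v, t) = Some (state c' Return, int v, ?t)"
        using c by (simp add: do reg Dec)
      also have "tm_steps M (state c' Return, int v, ?t) (state c' Home, 0, ?t)"
        by (rule steps_return[OF rep' c'])
      finally show ?thesis using rep' by blast
    qed
  next
    case (While r b k)
    have "tm_step M (state c Home, 0, t) = Some (state c' Home, 0, t)"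
      using c reg[of r 0] by (simp add: do While)
    then show ?thesis using rep unfolding While by blast
  next
    case (Read r q k)
    have "tm_steps M (state c Home, 0, t) (state c Home, int (s r), t)"
      by (rule steps_to_register_end[OF rep c]) (simp add: Read)
    also have "tm_step M (state c Home, int (s r), t) = Some (state c' Return, int (s r), t)"
      using c by (simp add: do reg digit Read)
    also have "tm_steps M (state c' Return, int (s r), t) (state c' Home, 0, t)"
      by (rule steps_return[OF rep c'])
    finally show ?thesis using rep Read by blast
  next
    case (Emit r)
    let ?b = "s r \<noteq> 0" and ?h = "- int (Suc (length out))"
    let ?t = "t(?h := Bit ?b)"
    have out: "t (- int (Suc z)) = (if z < length out then Bit (out ! (length out - Suc z)) else Blank)" for z
      using rep unfolding tape_rep_def by blast
    have neg: "- int (Suc x) \<noteq> int z" for x z by simp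
    have rep': "tape_rep K w s' out' ?t"
      using rep unfolding tape_rep_def Emit
      by (simp add: nth_Cons' less_Suc_eq neg neg[symmetric] Suc_diff_Suc del: of_nat_Suc) 
    have bits: "\<exists>b. t x = Bit b" if "?h < x" "x < 0" for x
    proof -
      have "x = - int (Suc (nat (- x - 1)))" using that by simp
      then show ?thesis using out[of "nat (- x - 1)"] that by auto
    qed
    have "tm_step M (state c Home, 0, t) = Some (state c' (Write ?b), - 1, t)"
      using c reg[of r 0] by (simp add: do Emit)
    also have "tm_steps M (state c' (Write ?b), - 1, t) (state c' (Write ?b), - 1 - int (length out), t)"
    proof (rule walk_left)
      fix x assume "- 1 - int (length out) < x" "x \<le> - 1"
      then have "t x \<noteq> Blank" using bits[of x] by auto
      then show "tm_step M (state c' (Write ?b), x, t) = Some (state c' (Write ?b), x - 1, t)"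
        using c' by (simp add: do)
    qed
    also have "tm_step M (state c' (Write ?b), - 1 - int (length out), t) = Some (state c' Forward, - int (length out), ?t)"
      using c' out[of "length out"] by (simp add: do algebra_simps)
    also have "tm_steps M (state c' Forward, - int (length out), ?t) (state c' Forward, - int (length out) + int (length out), ?t)"
    proof (rule walk_right)
      fix x assume x: "- int (length out) \<le> x" "x < - int (length out) + int (length out)"
      then obtain b where "?t x = Bit b" using bits[of x] by auto
      then have "0 \<notin> cell (?t x)" by simp
      moreover have "?t x \<in> symbols K" using rep' unfolding tape_rep_def by blast
      ultimately show "tm_step M (state c' Forward, x, ?t) = Some (state c' Forward, x + 1, ?t)"
        using c' by (simp del: fun_upd_apply add: step_state)
    qed
    also have "tm_step M (state c' Forward, - int (length out) + int (length out), ?t) = Some (state c' Home, 0, ?t)"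
      using c' home[of 0] by (auto simp: step_state sym fun_eq_iff)
    finally show ?thesis using rep' by blast
  qed
qed

lemma simulate_steps:
  assumes "(prog_step w)\<^sup>*\<^sup>* a a'" "a = (c, s, out)" "a' = (c', s', out')"
    and "tape_rep K w s out t" "c \<in> C"
  shows "c' \<in> C \<and> (\<exists>t'. tape_rep K w s' out' t' \<and> tm_steps M (state c Home, 0, t) (state c' Home, 0, t'))"
  using assms
proof (induction arbitrary: c' s' out' rule: rtranclp_induct)
  case (step y z)
  obtain d u v where y: "y = (d, u, v)" using prod_cases3 by blast
  obtain t1 where t1: "d \<in> C" "tape_rep K w u v t1" "tm_steps M (state c Home, 0, t) (state d Home, 0, t1)"
    using step y by blast
  have ps: "prog_step w (d, u, v) (c', s', out')" using step y by simp
  obtain t2 where "tape_rep K w s' out' t2" "tm_steps M (state d Home, 0, t1) (state c' Home, 0, t2)"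
    using simulate_step[OF ps t1(2,1)] by blast
  then show ?case using t1 closed prog_step_succs[OF ps] by (meson rtranclp_trans)
qed auto

lemma compiled_correct:
  assumes p: "p \<in> C" and run: "(prog_step w)\<^sup>*\<^sup>* (p, \<lambda>_. 0, []) ([], s, out)"
  shows "tm_fun M w = Some out"
proof -
  let ?init = "\<lambda>z. if 0 \<le> z \<and> z < int (length w) then Bit (w ! nat z) else Blank"
  let ?t = "?init(0 := cell_symbol (insert 0 (cell (?init 0))))"
  have sym0: "?init z \<in> symbols K" for z by (simp add: symbols_def)
  have "insert 0 (cell (?init 0)) \<subseteq> {..<K + 3}" using cell_subset[OF sym0, of 0] by simp
  then have sym1: "?t z \<in> symbols K" for z using sym0[of z] cell_symbol_in_symbols by simp
  have neg: "- int (Suc x) < 0" for x by simp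
  have rep: "tape_rep K w (\<lambda>_. 0) [] ?t"
    unfolding tape_rep_def
  proof (intro conjI allI)
    show "?t x \<in> symbols K" for x by (rule sym1)
    show "(0 \<in> cell (?t (int x))) = (x = 0)" for x by simp
    show "cell_digit (?t (int x)) = input_digit w x" for x
      by (simp add: cell_digit_def input_digit_def)
    show "(r + 3 \<in> cell (?t (int x))) = (x < 0)" for x r by simp
    show "?t (- int (Suc x)) = (if x < length [] then Bit ([] ! (length [] - Suc x)) else Blank)" for x
      using neg[of x] by (simp del: of_nat_Suc)
  qed
  have init: "tm_step M (tm_init w) = Some (state p Home, 0, ?t)"
    unfolding tm_init_def by (rule step_start) (use sym0[of 0] in simp)
  obtain t where Nil: "[] \<in> C" and t: "tape_rep K w s out t"
      "tm_steps M (state p Home, 0, ?t) (state [] Home, 0, t)"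
    using simulate_steps[OF run refl refl rep p] by blast
  have sym: "t z \<in> symbols K" for z using t by (simp add: tape_rep_def)
  have home: "0 \<in> cell (t (int z)) \<longleftrightarrow> z = 0" for z using t by (simp add: tape_rep_def)
  have out: "t (- int (Suc z)) = (if z < length out then Bit (out ! (length out - Suc z)) else Blank)" for z
    using t unfolding tape_rep_def by blast
  have outx: "t x = Bit (out ! nat (int (length out) + x))" if "- int (length out) \<le> x" "x < 0" for x
  proof -
    define k where "k = nat (- x - 1)"
    have k: "x = - int (Suc k)" "k < length out" using that by (auto simp: k_def)
    then have "length out - Suc k = nat (int (length out) + x)" by linarith
    then show ?thesis using out[of k] k by simp
  qed
  note r_into_rtranclp[of "\<lambda>a b. tm_step M a = Some b", OF init]
  note steps0 = rtranclp_trans[OF this t(2)]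
  have step1: "tm_step M (state [] Home, 0, t) = Some (state [] Finish, - 1, t)"
    using Nil by (simp add: step_state sym)
  have steps2: "tm_steps M (state [] Finish, - 1, t) (state [] Finish, - 1 - int (length out), t)"
  proof (rule walk_left)
    fix x assume "- 1 - int (length out) < x" "x \<le> - 1"
    then have "t x \<noteq> Blank" using outx[of x] by auto
    then show "tm_step M (state [] Finish, x, t) = Some (state [] Finish, x - 1, t)"
      using Nil by (simp add: step_state sym)
  qed
  have step3: "tm_step M (state [] Finish, - 1 - int (length out), t) = Some (state [] Stop, - int (length out), t)"
  proof -
    have "t (- 1 - int (length out)) = Blank" using out[of "length out"] by simp
    then show ?thesis using Nil by (simp add: step_state sym fun_upd_idem)
  qed
  have steps: "tm_steps M (tm_init w) (state [] Stop, - int (length out), t)"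
    by (rule rtranclp.rtrancl_into_rtrancl[OF rtranclp_trans[OF
          rtranclp.rtrancl_into_rtrancl[OF steps0 step1] steps2] step3])
  have halt: "tm_step M (state [] Stop, - int (length out), t) = None"
    using Nil by (simp add: step_state sym)
  have "tm_output (state [] Stop, - int (length out), t) = out"
  proof -
    have least: "(LEAST k. t (- int (length out) + int k) \<notin> range Bit) = length out"
    proof (rule Least_equality)
      have "0 \<in> cell (t 0)" using home[of 0] by simp
      then show "t (- int (length out) + int (length out)) \<notin> range Bit"
        by (auto split: if_splits)
      show "length out \<le> k" if k: "t (- int (length out) + int k) \<notin> range Bit" for k
      proof (rule ccontr)
        assume "\<not> length out \<le> k"
        then have "t (- int (length out) + int k) \<in> range Bit"
          by (subst outx) simp_all
        then show False using k by blast
      qed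
    qed
    have bit: "t (int k - int (length out)) = Bit (out ! k)" if "k < length out" for k
      using that by (subst outx) simp_all
    show ?thesis
      unfolding tm_output.simps least by (rule nth_equalityI) (simp_all add: bit)
  qed
  then show ?thesis using tm_fun_steps[OF steps halt] by simp
qed

end

theorem program_to_tm:
  "\<exists>M. \<forall>w s out. (prog_step w)\<^sup>*\<^sup>* (p, \<lambda>_. 0, []) ([], s, out) \<longrightarrow> tm_fun M w = Some out"
proof -
  define C where "C = conts p []"
  have fin: "finite C" by (simp add: C_def finite_conts)
  define K where "K = Suc (Max (insert 0 (head_register ` C)))"
  have K: "head_register c < K" if "c \<in> C" for c
    using that fin by (simp add: K_def less_Suc_eq_le)
  obtain M where M: "map_of M = transition p C K"
    using ex_table[OF finite_dom_transition[OF fin]] by blast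
  interpret compiled p C K M
  proof
    show "d \<in> C" if "c \<in> C" "d \<in> succs c" for c d
      using that conts_closed[of c p "[]" d] conts_closed by (cases c) (auto simp: C_def)
  qed (use K M in auto)
  have "p \<in> C" using conts_entry[of p "[]"] by (simp add: C_def)
  then show ?thesis using compiled_correct by blast
qed

section \<open>Primitive recursion on registers\<close>

text \<open>
Quantification over the continuation \<open>k\<close> makes this relation compositional under concatenation.
\<close>

definition runs :: "bool list \<Rightarrow> instr list \<Rightarrow> (nat \<Rightarrow> nat) \<times> bool list \<Rightarrow> (nat \<Rightarrow> nat) \<times> bool list \<Rightarrow> bool" where
  "runs w c a b \<longleftrightarrow> (\<forall>k. (prog_step w)\<^sup>*\<^sup>* (c @ k, a) (k, b))"

lemma runs_Nil: "a = b \<Longrightarrow> runs w [] a b"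
  by (simp add: runs_def)

lemma runs_append: "runs w c a b \<Longrightarrow> runs w d b e \<Longrightarrow> runs w (c @ d) a e"
  by (fastforce simp: runs_def intro: rtranclp_trans)

lemma runs_Cons: "runs w [i] a b \<Longrightarrow> runs w c b e \<Longrightarrow> runs w (i # c) a e"
  using runs_append[of w "[i]" a b c e] by simp

lemma runs_Inc: "runs w c (s(r := Suc (s r)), out) b \<Longrightarrow> runs w (Inc r # c) (s, out) b"
  unfolding runs_def append_Cons using converse_rtranclp_into_rtranclp prog_step.Inc by metis

lemma runs_Dec: "runs w c (s(r := s r - 1), out) b \<Longrightarrow> runs w (Dec r # c) (s, out) b"
  unfolding runs_def append_Cons using converse_rtranclp_into_rtranclp prog_step.Dec by metis

lemma runs_Emit: "runs w [Emit r] (s, out) (s, (s r \<noteq> 0) # out)"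
  using prog_step.Emit by (auto simp: runs_def)

lemma runs_Incs:
  "s' = s(q := s q + n) \<Longrightarrow> runs w (replicate n (Inc q)) (s, out) (s', out)"
proof (induction n arbitrary: s)
  case (Suc n)
  show ?case
    unfolding replicate_Suc by (intro runs_Inc Suc.IH) (auto simp: Suc.prems)
qed (simp add: runs_Nil)

lemma runs_Read: "runs w [Read r q] (s, out) (s(q := s q + input_digit w (s r)), out)"
  unfolding runs_def
proof
  fix k
  have "prog_step w ([Read r q] @ k, s, out) (replicate (input_digit w (s r)) (Inc q) @ k, s, out)"
    using prog_step.Read by simp
  moreover have "(prog_step w)\<^sup>*\<^sup>* (replicate (input_digit w (s r)) (Inc q) @ k, s, out)
      (k, s(q := s q + input_digit w (s r)), out)"
    using runs_Incs unfolding runs_def by blast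
  ultimately show "(prog_step w)\<^sup>*\<^sup>* ([Read r q] @ k, s, out) (k, s(q := s q + input_digit w (s r)), out)"
    by (rule converse_rtranclp_into_rtranclp)
qed

lemma runs_While_False: "s r = 0 \<Longrightarrow> runs w [While r c] (s, out) (s, out)"
  using prog_step.While[of w r c _ s out] by (auto simp: runs_def)

lemma runs_While_True:
  assumes "s r \<noteq> 0" "runs w c (s, out) b" "runs w [While r c] b e"
  shows "runs w [While r c] (s, out) e"
  unfolding runs_def
proof
  fix k
  have "prog_step w ([While r c] @ k, s, out) (c @ [While r c] @ k, s, out)"
    using prog_step.While[of w r c k s out] assms(1) by simp
  moreover have "(prog_step w)\<^sup>*\<^sup>* (c @ [While r c] @ k, s, out) ([While r c] @ k, b)"
    using assms(2) unfolding runs_def by blast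
  moreover have "(prog_step w)\<^sup>*\<^sup>* ([While r c] @ k, b) (k, e)"
    using assms(3) unfolding runs_def by blast
  ultimately show "(prog_step w)\<^sup>*\<^sup>* ([While r c] @ k, s, out) (k, e)"
    by (meson converse_rtranclp_into_rtranclp rtranclp_trans)
qed

text \<open>
A loop is handled by giving its states \<open>S i\<close> after \<open>i\<close> rounds in closed form.
\<close>

lemma runs_While:
  assumes "\<And>i. i < n \<Longrightarrow> S i r \<noteq> 0"
    and "\<And>i. i < n \<Longrightarrow> runs w c (S i, out) (S (Suc i), out)"
    and "S n r = 0" "s = S 0" "s' = S n"
  shows "runs w [While r c] (s, out) (s', out)"
proof -
  have "runs w [While r c] (S (n - j), out) (S n, out)" if "j \<le> n" for j
    using that
  proof (induction j)
    case 0
    then show ?case using assms(3) by (simp add: runs_While_False)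
  next
    case (Suc j)
    then have "runs w c (S (n - Suc j), out) (S (n - j), out)"
      using assms(2)[of "n - Suc j"] by (simp add: Suc_diff_Suc)
    then show ?case using Suc assms(1)[of "n - Suc j"] by (intro runs_While_True) auto
  qed
  from this[of n] show ?thesis using assms by simp
qed

lemma runs_clear: "runs w [While a [Dec a]] (s, out) (s(a := 0), out)"
proof (rule runs_While[where S = "\<lambda>i. s(a := s a - i)" and n = "s a"])
  show "runs w [Dec a] (s(a := s a - i), out) (s(a := s a - Suc i), out)" for i
    by (intro runs_Dec runs_Nil) simp
qed auto

lemma runs_move:
  assumes "a \<noteq> b"
  shows "runs w [While a [Dec a, Inc b]] (s, out) (s(a := 0, b := s b + s a), out)"
proof (rule runs_While)
  let ?S = "\<lambda>i. s(a := s a - i, b := s b + i)"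
  show "runs w [Dec a, Inc b] (?S i, out) (?S (Suc i), out)" if "i < s a" for i
    using assms by (intro runs_Dec runs_Inc runs_Nil) (auto simp: fun_eq_iff)
  show "s = ?S 0" "?S (s a) a = 0" using assms by auto
  show "s(a := 0, b := s b + s a) = ?S (s a)" by simp
qed (use assms in auto)

lemma runs_copy:
  assumes "a \<noteq> b" "a \<noteq> c" "b \<noteq> c" "s c = 0"
  shows "runs w [While a [Dec a, Inc b, Inc c], While c [Dec c, Inc a]] (s, out) (s(b := s b + s a), out)"
proof (rule runs_Cons)
  let ?S = "\<lambda>i. s(a := s a - i, b := s b + i, c := i)"
  show "runs w [While a [Dec a, Inc b, Inc c]] (s, out) (?S (s a), out)"
  proof (rule runs_While)
    show "runs w [Dec a, Inc b, Inc c] (?S i, out) (?S (Suc i), out)" if "i < s a" for i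
      using that assms by (intro runs_Dec runs_Inc runs_Nil) (auto simp: fun_eq_iff)
    show "s = ?S 0" "?S (s a) a = 0" using assms by auto
  qed (use assms in auto)
  have "s(b := s b + s a) = (?S (s a))(c := 0, a := ?S (s a) a + ?S (s a) c)"
    using assms by (auto simp: fun_eq_iff)
  then show "runs w [While c [Dec c, Inc a]] (?S (s a), out) (s(b := s b + s a), out)"
    using runs_move[of c a w "?S (s a)" out] assms by simp
qed

text \<open>
\<open>f\<close> depends on the registers below \<open>m\<close> only and is computed by a program.  The program has to work
for every placement \<open>\<rho>\<close> of the arguments below a register \<open>k\<close> and may use all registers from \<open>k\<close> on
as scratch space, provided that it leaves them clean apart from the result in \<open>k\<close>.  The freedom in
\<open>\<rho>\<close> permits a bound variable of a recursion, which is register \<open>m\<close> in the term, to reside elsewhere at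
run time; hence an additional argument can be introduced without renaming anything
(\<open>computable_mono\<close>).
\<close>

definition computable :: "nat \<Rightarrow> ((nat \<Rightarrow> nat) \<Rightarrow> nat) \<Rightarrow> bool" where
  "computable m f \<longleftrightarrow>
     (\<forall>s s'. (\<forall>r<m. s r = s' r) \<longrightarrow> f s = f s') \<and>
     (\<forall>\<rho> k. (\<forall>r<m. \<rho> r < k) \<longrightarrow>
        (\<exists>c. \<forall>w s out. (\<forall>r\<ge>k. s r = 0) \<longrightarrow>
           runs w c (s, out) (s(k := f (\<lambda>r. s (\<rho> r))), out)))"

lemma computableI:
  assumes "\<And>s s'. (\<And>r. r < m \<Longrightarrow> s r = s' r) \<Longrightarrow> f s = f s'"
    and "\<And>\<rho> k. (\<And>r. r < m \<Longrightarrow> \<rho> r < k) \<Longrightarrow>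
      \<exists>c. \<forall>w s out. (\<forall>r\<ge>k. s r = 0) \<longrightarrow> runs w c (s, out) (s(k := f (\<lambda>r. s (\<rho> r))), out)"
  shows "computable m f"
  unfolding computable_def
proof (intro conjI allI impI)
  show "f s = f s'" if "\<forall>r<m. s r = s' r" for s s'
    by (rule assms(1)) (use that in simp)
  show "\<exists>c. \<forall>w s out. (\<forall>r\<ge>k. s r = 0) \<longrightarrow> runs w c (s, out) (s(k := f (\<lambda>r. s (\<rho> r))), out)"
    if "\<forall>r<m. \<rho> r < k" for \<rho> k
    by (rule assms(2)) (use that in simp)
qed

lemma computable_program:
  assumes "computable m f" "\<And>r. r < m \<Longrightarrow> \<rho> r < k"
  shows "\<exists>c. \<forall>w s out. (\<forall>r\<ge>k. s r = 0) \<longrightarrow> runs w c (s, out) (s(k := f (\<lambda>r. s (\<rho> r))), out)"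
proof -
  have "\<forall>r<m. \<rho> r < k" using assms(2) by simp
  then show ?thesis using conjunct2[OF assms(1)[unfolded computable_def]] by blast
qed

lemma computable_cong:
  assumes "computable m f" "\<And>r. r < m \<Longrightarrow> s r = s' r"
  shows "f s = f s'"
  using conjunct1[OF assms(1)[unfolded computable_def]] assms(2) by blast

lemma computable_upd:
  assumes "computable m f"
  shows "f (s(m := i)) = f s" "f (s(m := i, Suc m := j)) = f s"
  by (rule computable_cong[OF assms]; simp)+

lemma computable_mono:
  assumes "computable m f" "m \<le> m'"
  shows "computable m' f"
proof (rule computableI)
  show "f s = f s'" if "\<And>r. r < m' \<Longrightarrow> s r = s' r" for s s'
    by (rule computable_cong[OF assms(1)]) (use that assms(2) in simp)
  show "\<exists>c. \<forall>w s out. (\<forall>r\<ge>k. s r = 0) \<longrightarrow> runs w c (s, out) (s(k := f (\<lambda>r. s (\<rho> r))), out)"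
    if "\<And>r. r < m' \<Longrightarrow> \<rho> r < k" for \<rho> k
  proof -
    have "\<forall>r<m. \<rho> r < k" using that assms(2) by simp
    then show ?thesis using conjunct2[OF assms(1)[unfolded computable_def]] by blast
  qed
qed

lemma computable_register:
  assumes "r < m"
  shows "computable m (\<lambda>s. s r)"
proof (rule computableI)
  fix \<rho> k assume \<rho>: "\<And>r. r < m \<Longrightarrow> \<rho> r < (k::nat)"
  let ?c = "[While (\<rho> r) [Dec (\<rho> r), Inc k, Inc (Suc k)], While (Suc k) [Dec (Suc k), Inc (\<rho> r)]]"
  have "runs w ?c (s, out) (s(k := s (\<rho> r)), out)" if "\<forall>r\<ge>k. s r = 0" for w s out
  proof -
    have "\<rho> r < k" using \<rho> assms by simp
    then show ?thesis using runs_copy[of "\<rho> r" k "Suc k" s w out] that by simp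
  qed
  then show "\<exists>c. \<forall>w s out. (\<forall>r\<ge>k. s r = 0) \<longrightarrow> runs w c (s, out) (s(k := s (\<rho> r)), out)"
    by blast
qed (use assms in auto)

lemma computable_zero: "computable m (\<lambda>s. 0)"
proof -
  have "runs w [] (s, out) (s(k := 0), out)" if "\<forall>r\<ge>k. s r = 0" for w s out k
    using that by (intro runs_Nil) (simp add: fun_upd_idem)
  then show ?thesis by (intro computableI) blast+
qed

lemma computable_Suc:
  assumes "computable m f"
  shows "computable m (\<lambda>s. Suc (f s))"
proof (rule computableI)
  show "Suc (f s) = Suc (f s')" if "\<And>r. r < m \<Longrightarrow> s r = s' r" for s s'
    using computable_cong[OF assms, of s s'] that by simp
  fix \<rho> k assume \<rho>: "\<And>r. r < m \<Longrightarrow> \<rho> r < (k::nat)"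
  obtain c where "\<forall>w s out. (\<forall>r\<ge>k. s r = 0) \<longrightarrow> runs w c (s, out) (s(k := f (\<lambda>r. s (\<rho> r))), out)"
    using computable_program[of m f \<rho> k, OF assms \<rho>] unfolding id_apply ..
  note c = this[rule_format]
  have "runs w (c @ [Inc k]) (s, out) (s(k := Suc (f (\<lambda>r. s (\<rho> r)))), out)" if "\<forall>r\<ge>k. s r = 0" for w s out
    by (rule runs_append[OF c]) (use that in \<open>simp_all add: runs_Inc runs_Nil\<close>)
  then show "\<exists>c. \<forall>w s out. (\<forall>r\<ge>k. s r = 0) \<longrightarrow>
      runs w c (s, out) (s(k := Suc (f (\<lambda>r. s (\<rho> r)))), out)"
    by blast
qed

text \<open>
Primitive recursion, with the loop index and the accumulator as the bound variables \<open>m\<close> and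
\<open>Suc m\<close> of the step function \<open>g\<close>.  At run time register \<open>k\<close> counts down the remaining rounds,
\<open>k + 1\<close> holds the index, \<open>k + 2\<close> the accumulator and \<open>k + 3\<close> the value of the step.
\<close>

lemma computable_rec_nat:
  assumes a: "computable m a" and z: "computable m z" and g: "computable (Suc (Suc m)) g"
    and h: "\<And>s i x. g (s(m := i, Suc m := x)) = h s i x"
  shows "computable m (\<lambda>s. rec_nat (z s) (h s) (a s))"
proof (rule computableI)
  fix s s' :: "nat \<Rightarrow> nat" assume s: "\<And>r. r < m \<Longrightarrow> s r = s' r"
  have "h s i x = h s' i x" for i x
    unfolding h[symmetric] by (rule computable_cong[OF g]) (use s in \<open>auto simp: less_Suc_eq\<close>)
  then have "h s = h s'" by (intro ext)
  then show "rec_nat (z s) (h s) (a s) = rec_nat (z s') (h s') (a s')"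
    using computable_cong[OF a, of s s'] computable_cong[OF z, of s s'] s by simp
next
  fix \<rho> k assume \<rho>: "\<And>r. r < m \<Longrightarrow> \<rho> r < (k::nat)"
  obtain ca where "\<forall>w s out. (\<forall>r\<ge>k. s r = 0) \<longrightarrow> runs w ca (s, out) (s(k := a (\<lambda>r. s (\<rho> r))), out)"
    using computable_program[of m a \<rho> k, OF a \<rho>] unfolding id_apply ..
  note ca = this[rule_format]
  have \<rho>2: "\<rho> r < k + 2" if "r < m" for r using \<rho>[OF that] by simp
  obtain cz where "\<forall>w s out. (\<forall>r\<ge>k + 2. s r = 0) \<longrightarrow> runs w cz (s, out) (s(k + 2 := z (\<lambda>r. s (\<rho> r))), out)"
    using computable_program[of m z \<rho> "k + 2", OF z \<rho>2] unfolding id_apply ..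
  note cz = this[rule_format]
  define \<rho>' where "\<rho>' = \<rho>(m := k + 1, Suc m := k + 2)"
  have \<rho>': "\<rho>' r < k + 3" if "r < Suc (Suc m)" for r
    using that \<rho>[of r] by (auto simp: \<rho>'_def less_Suc_eq)
  obtain cg where "\<forall>w s out. (\<forall>r\<ge>k + 3. s r = 0) \<longrightarrow> runs w cg (s, out) (s(k + 3 := g (\<lambda>r. s (\<rho>' r))), out)"
    using computable_program[of _ g \<rho>' "k + 3", OF g \<rho>'] unfolding id_apply ..
  note cg = this[rule_format]
  let ?body = "[Dec k] @ cg @ [While (k+2) [Dec (k+2)]] @ [While (k+3) [Dec (k+3), Inc (k+2)]] @ [Inc (k+1)]"
  let ?c = "ca @ cz @ [While k ?body] @ [While (k+1) [Dec (k+1)]] @ [While (k+2) [Dec (k+2), Inc k]]"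
  have "runs w ?c (s, out) (s(k := rec_nat (z (\<lambda>r. s (\<rho> r))) (h (\<lambda>r. s (\<rho> r))) (a (\<lambda>r. s (\<rho> r)))), out)"
    if s: "\<forall>r\<ge>k. s r = 0" for w s out
  proof -
    let ?s = "\<lambda>r. s (\<rho> r)"
    define n where "n = a ?s"
    define R where "R = rec_nat (z ?s) (h ?s)"
    define S where "S i = s(k := n - i, k + 1 := i, k + 2 := R i)" for i
    have "runs w ca (s, out) (s(k := n), out)" using ca[of s w out] s by (simp add: n_def)
    moreover have "runs w cz (s(k := n), out) (S 0, out)"
    proof -
      have "z (\<lambda>r. (s(k := n)) (\<rho> r)) = z ?s"
        by (rule computable_cong[OF z]) (use \<rho> in auto)
      moreover have "(s(k := n))(k + 2 := R 0) = S 0"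
        using s by (auto simp: S_def fun_eq_iff)
      ultimately show ?thesis using cz[of "s(k := n)" w out] s by (simp add: R_def)
    qed
    moreover have "runs w [While k ?body] (S 0, out) (S n, out)"
    proof (rule runs_While)
      fix i assume i: "i < n"
      let ?S1 = "(S i)(k := n - Suc i)"
      let ?S2 = "?S1(k + 3 := R (Suc i))"
      let ?S3 = "?S2(k + 2 := 0)"
      let ?S4 = "?S3(k + 3 := 0, k + 2 := ?S3 (k + 2) + ?S3 (k + 3))"
      have "runs w [Dec k] (S i, out) (?S1, out)"
        by (intro runs_Dec runs_Nil) (simp add: S_def)
      moreover have "runs w cg (?S1, out) (?S2, out)"
      proof -
        have "\<rho> r \<noteq> k \<and> \<rho> r \<noteq> k + 1 \<and> \<rho> r \<noteq> k + 2" if "r < m" for r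
          using \<rho>[OF that] by simp
        then have "g (\<lambda>r. ?S1 (\<rho>' r)) = g (?s(m := i, Suc m := R i))"
          by (intro computable_cong[OF g]) (use \<rho> in \<open>auto simp: \<rho>'_def S_def less_Suc_eq\<close>)
        also have "\<dots> = R (Suc i)" by (simp add: h R_def)
        finally show ?thesis using cg[of ?S1 w out] s by (simp add: S_def)
      qed
      moreover have "runs w [While (k+2) [Dec (k+2)]] (?S2, out) (?S3, out)"
        by (rule runs_clear)
      moreover have "runs w [While (k+3) [Dec (k+3), Inc (k+2)]] (?S3, out) (?S4, out)"
        by (rule runs_move) simp
      moreover have "runs w [Inc (k+1)] (?S4, out) (S (Suc i), out)"
      proof -
        have "?S4(k + 1 := Suc (?S4 (k + 1))) = S (Suc i)"
          using s by (auto simp: S_def fun_eq_iff)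
        then show ?thesis by (intro runs_Inc runs_Nil) simp
      qed
      ultimately show "runs w ?body (S i, out) (S (Suc i), out)"
        by (intro runs_append)
    qed (auto simp: S_def)
    moreover have "runs w [While (k+1) [Dec (k+1)]] (S n, out) ((S n)(k+1 := 0), out)"
      by (rule runs_clear)
    moreover have "runs w [While (k+2) [Dec (k+2), Inc k]] ((S n)(k+1 := 0), out) (s(k := R n), out)"
    proof -
      let ?T = "(S n)(k+1 := 0)"
      have "?T(k+2 := 0, k := ?T k + ?T (k + 2)) = s(k := R n)"
        using s by (auto simp: S_def fun_eq_iff)
      then show ?thesis using runs_move[of "k + 2" k w ?T out] by simp
    qed
    ultimately show ?thesis unfolding n_def[symmetric] R_def[symmetric] by (intro runs_append)
  qed
  then show "\<exists>c. \<forall>w s out. (\<forall>r\<ge>k. s r = 0) \<longrightarrow>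
      runs w c (s, out) (s(k := rec_nat (z (\<lambda>r. s (\<rho> r))) (h (\<lambda>r. s (\<rho> r))) (a (\<lambda>r. s (\<rho> r)))), out)"
    by blast
qed

named_theorems computable_intros

lemmas [computable_intros] = computable_zero computable_Suc

lemma computable_const [computable_intros]: "computable m (\<lambda>s. c)"
  by (induction c) (simp_all add: computable_zero computable_Suc)

lemma computable_weaken: "computable m f \<Longrightarrow> computable (Suc m) f" "computable m f \<Longrightarrow> computable (Suc (Suc m)) f"
  by (auto elim: computable_mono)

lemma computable_add [computable_intros]:
  assumes "computable m f" "computable m g"
  shows "computable m (\<lambda>s. f s + g s)"
proof -
  have "computable m (\<lambda>s. rec_nat (f s) (\<lambda>i x. Suc x) (g s))"
    by (rule computable_rec_nat[OF assms(2,1), of "\<lambda>s. Suc (s (Suc m))"])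
      (auto intro: computable_Suc computable_register)
  moreover have "rec_nat x (\<lambda>i x. Suc x) y = x + y" for x y :: nat by (induction y) auto
  ultimately show ?thesis by simp
qed

lemma computable_diff [computable_intros]:
  assumes "computable m f" "computable m g"
  shows "computable m (\<lambda>s. f s - g s)"
proof -
  have pred: "computable k (\<lambda>s. h s - Suc 0)" if "computable k h" for k h
  proof -
    have "computable k (\<lambda>s. rec_nat 0 (\<lambda>i x. i) (h s))"
      by (rule computable_rec_nat[OF that computable_zero, of "\<lambda>s. s k"])
        (auto intro: computable_register)
    moreover have "rec_nat 0 (\<lambda>i x. i) y = y - 1" for y :: nat by (cases y) auto
    ultimately show ?thesis by simp
  qed
  have "computable m (\<lambda>s. rec_nat (f s) (\<lambda>i x. x - Suc 0) (g s))"
    by (rule computable_rec_nat[OF assms(2,1), of "\<lambda>s. s (Suc m) - Suc 0"])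
      (auto intro: pred computable_register)
  moreover have "rec_nat x (\<lambda>i x. x - Suc 0) y = x - y" for x y :: nat by (induction y) auto
  ultimately show ?thesis by simp
qed

text \<open>
The summation index is the bound variable \<open>m\<close>.  The last hypothesis says that \<open>h\<close> does not read
register \<open>m\<close> except through its second argument; it is what makes \<open>h\<close> recoverable from
\<open>h s (s m)\<close>.
\<close>

lemma computable_sum [computable_intros]:
  assumes f: "computable m f" and h: "computable (Suc m) (\<lambda>s. h s (s m))"
    and indep: "\<And>s i j. h (s(m := i)) j = h s j"
  shows "computable m (\<lambda>s. \<Sum>i<f s. h s i)"
proof -
  have upd: "h (s(m := i, Suc m := x)) i = h s i" for s i x
    using computable_upd(1)[OF h, of "s(m := i)" x] indep by simp
  have "computable m (\<lambda>s. rec_nat 0 (\<lambda>i x. x + h s i) (f s))"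
    by (rule computable_rec_nat[OF f computable_zero, of "\<lambda>s. s (Suc m) + h s (s m)"])
      (auto intro!: computable_add computable_weaken(1)[OF h] computable_register simp: upd)
  moreover have "rec_nat 0 (\<lambda>i x. x + h s i) y = (\<Sum>i<y. h s i)" for s and y :: nat
    by (induction y) auto
  ultimately show ?thesis by simp
qed

lemma computable_mult [computable_intros]:
  assumes "computable m f" "computable m g"
  shows "computable m (\<lambda>s. f s * g s)"
proof -
  have "computable m (\<lambda>s. \<Sum>i<f s. g s)"
    by (intro computable_sum assms computable_weaken) (simp add: computable_upd[OF assms(2)])
  then show ?thesis by simp
qed

lemma computable_power [computable_intros]:
  assumes "computable m f" "computable m g"
  shows "computable m (\<lambda>s. f s ^ g s)"
proof -
  have "computable m (\<lambda>s. rec_nat 1 (\<lambda>i x. f s * x) (g s))"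
    by (rule computable_rec_nat[OF assms(2) computable_const, of "\<lambda>s. f s * s (Suc m)"])
      (auto intro!: computable_mult computable_weaken(2)[OF assms(1)] computable_register
        simp: computable_upd[OF assms(1)])
  moreover have "rec_nat 1 (\<lambda>i x. a * x) y = a ^ y" for a y :: nat by (induction y) auto
  ultimately show ?thesis by simp
qed

abbreviation decidable :: "nat \<Rightarrow> ((nat \<Rightarrow> nat) \<Rightarrow> bool) \<Rightarrow> bool" where
  "decidable m P \<equiv> computable m (\<lambda>s. of_bool (P s))"

lemma decidable_not [computable_intros]:
  assumes "decidable m P"
  shows "decidable m (\<lambda>s. \<not> P s)"
proof -
  have "computable m (\<lambda>s. 1 - of_bool (P s))"
    by (intro computable_diff computable_const assms)
  moreover have "1 - of_bool (P s) = (of_bool (\<not> P s) :: nat)" for s by simp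
  ultimately show ?thesis by simp
qed

lemma decidable_conj [computable_intros]:
  "decidable m P \<Longrightarrow> decidable m Q \<Longrightarrow> decidable m (\<lambda>s. P s \<and> Q s)"
  using computable_mult[of m "\<lambda>s. of_bool (P s)"] by (auto simp: of_bool_conj)

lemma decidable_disj [computable_intros]:
  "decidable m P \<Longrightarrow> decidable m Q \<Longrightarrow> decidable m (\<lambda>s. P s \<or> Q s)"
  using decidable_not[OF decidable_conj[OF decidable_not decidable_not]] by simp

lemma decidable_less [computable_intros]:
  assumes "computable m f" "computable m g"
  shows "decidable m (\<lambda>s. f s < g s)"
proof -
  \<comment> \<open>Truncated subtraction turns a positive difference into 1.\<close>
  have "computable m (\<lambda>s. 1 - (1 - (g s - f s)))"
    by (intro computable_diff computable_const assms)
  moreover have "1 - (1 - (g s - f s)) = of_bool (f s < g s)" for s by auto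
  ultimately show ?thesis by simp
qed

lemma decidable_le [computable_intros]:
  "computable m f \<Longrightarrow> computable m g \<Longrightarrow> decidable m (\<lambda>s. f s \<le> g s)"
  using decidable_not[OF decidable_less] by (simp add: not_less)

lemma decidable_eq [computable_intros]:
  "computable m f \<Longrightarrow> computable m g \<Longrightarrow> decidable m (\<lambda>s. f s = g s)"
  using decidable_conj[OF decidable_le decidable_le] by (simp add: eq_iff)

lemma decidable_ex [computable_intros]:
  assumes "computable m f" "decidable (Suc m) (\<lambda>s. P s (s m))"
    and "\<And>s i j. P (s(m := i)) j = P s j"
  shows "decidable m (\<lambda>s. \<exists>i<f s. P s i)"
proof -
  have "decidable m (\<lambda>s. 0 < (\<Sum>i<f s. of_bool (P s i) :: nat))"
    by (rule decidable_less[OF computable_const computable_sum[OF assms(1)]])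
      (use assms(2,3) in simp_all)
  moreover have "0 < (\<Sum>i<n. of_bool (Q i) :: nat) \<longleftrightarrow> (\<exists>i<n. Q i)" for n :: nat and Q
    by (auto simp: sum_eq_0_iff simp flip: neq0_conv)
  ultimately show ?thesis by simp
qed

lemma computable_div [computable_intros]:
  assumes "computable m f" "computable m g"
  shows "computable m (\<lambda>s. f s div g s)"
proof -
  have "computable m (\<lambda>s. \<Sum>k<f s. of_bool (0 < g s \<and> Suc k * g s \<le> f s))"
    by (intro computable_intros computable_weaken assms computable_register)
      (auto simp: computable_upd[OF assms(1)] computable_upd[OF assms(2)])
  moreover have "(\<Sum>k<x. of_bool (0 < y \<and> Suc k * y \<le> x)) = x div y" for x y :: nat
  proof (cases "y = 0")
    case False
    have "{k \<in> {..<x}. Suc k * y \<le> x} = {..<x div y}"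
    proof (intro equalityI subsetI)
      fix k assume k: "k \<in> {..<x div y}"
      then have "Suc k * y \<le> x div y * y" by (intro mult_le_mono1) simp
      also have "\<dots> \<le> x" by simp
      finally have "Suc k * y \<le> x" .
      moreover have "k < x" using k div_le_dividend[of x y] by (meson lessThan_iff order_less_le_trans)
      ultimately show "k \<in> {k \<in> {..<x}. Suc k * y \<le> x}" by simp
    qed (use False in \<open>auto simp: less_eq_div_iff_mult_less_eq simp flip: Suc_le_eq\<close>)
    then show ?thesis using False by (simp add: sum.If_cases of_bool_def Int_def)
  qed simp
  ultimately show ?thesis by simp
qed

lemma computable_mod [computable_intros]:
  assumes "computable m f" "computable m g"
  shows "computable m (\<lambda>s. f s mod g s)"
proof -
  have "computable m (\<lambda>s. f s - f s div g s * g s)"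
    by (intro computable_intros assms)
  then show ?thesis by (simp add: minus_div_mult_eq_mod)
qed


section \<open>Functions on numbers as Turing machines\<close>

definition nat_of_string :: "bool list \<Rightarrow> nat" where
  "nat_of_string w = foldl (\<lambda>v b. 2 * v + 1 + of_bool b) 0 w"

lemma nat_of_string_Nil [simp]: "nat_of_string [] = 0"
  by (simp add: nat_of_string_def)

lemma nat_of_string_snoc: "nat_of_string (w @ [b]) = 2 * nat_of_string w + 1 + of_bool b"
  by (simp add: nat_of_string_def)

lemma nat_of_string_of_nat [simp]: "nat_of_string (string_of_nat n) = n"
  by (induction n rule: string_of_nat.induct) (auto simp: nat_of_string_snoc)

lemma string_of_nat_of_string [simp]: "string_of_nat (nat_of_string w) = w"
  using bij_string_of_nat by (metis bij_pointE nat_of_string_of_nat)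

definition read_program :: "instr list" where
  "read_program =
     [Read 0 2] @ [While 2 ([While 1 [Dec 1, Inc 3, Inc 3]] @ [While 3 [Dec 3, Inc 1]] @
        [While 2 [Dec 2, Inc 1]] @ [Inc 0] @ [Read 0 2])] @ [While 0 [Dec 0]] @ [While 1 [Dec 1, Inc 0]]"

lemma runs_read_program:
  "runs w read_program (\<lambda>_. 0, out) ((\<lambda>_::nat. 0::nat)(0 := nat_of_string w), out)"
proof -
  let ?body = "[While 1 [Dec 1, Inc 3, Inc 3]] @ [While 3 [Dec 3, Inc 1]] @
        [While 2 [Dec 2, Inc 1]] @ [Inc 0] @ [Read 0 2]"
  define S where "S i = (\<lambda>_::nat. 0::nat)(0 := i, 1 := nat_of_string (take i w), 2 := input_digit w i)" for i :: nat
  have double: "runs w [While 1 [Dec 1, Inc 3, Inc 3]] (s, out) (s(1 := 0, 3 := 2 * s 1), out)" if "s 3 = 0" for s :: "nat \<Rightarrow> nat"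
  proof (rule runs_While)
    let ?S = "\<lambda>i. s(1 := s 1 - i, 3 := 2 * i)"
    show "runs w [Dec 1, Inc 3, Inc 3] (?S i, out) (?S (Suc i), out)" if "i < s 1" for i
      using that by (intro runs_Dec runs_Inc runs_Nil) (auto simp: fun_eq_iff)
    show "s = ?S 0" using that by auto
    show "s(1 := 0, 3 := 2 * s 1) = ?S (s 1)" by simp
  qed auto
  have "runs w [Read 0 2] (\<lambda>_. 0, out) (S 0, out)"
  proof -
    have "(\<lambda>_::nat. 0::nat)(2 := input_digit w 0) = S 0" by (auto simp: S_def fun_eq_iff)
    then show ?thesis using runs_Read[of w 0 2 "\<lambda>_. 0" out] by simp
  qed
  moreover have "runs w [While 2 ?body] (S 0, out) (S (length w), out)"
  proof (rule runs_While)
    fix i assume i: "i < length w"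
    let ?S1 = "(S i)(1 := 0, 3 := 2 * S i 1)"
    let ?S2 = "?S1(3 := 0, 1 := ?S1 1 + ?S1 3)"
    let ?S3 = "?S2(2 := 0, 1 := ?S2 1 + ?S2 2)"
    let ?S4 = "?S3(0 := Suc (?S3 0))"
    have "runs w [While 1 [Dec 1, Inc 3, Inc 3]] (S i, out) (?S1, out)"
      by (rule double) (simp add: S_def)
    moreover have "runs w [While 3 [Dec 3, Inc 1]] (?S1, out) (?S2, out)"
      by (rule runs_move) simp
    moreover have "runs w [While 2 [Dec 2, Inc 1]] (?S2, out) (?S3, out)"
      by (rule runs_move) simp
    moreover have "runs w [Inc 0] (?S3, out) (?S4, out)" by (intro runs_Inc runs_Nil) simp
    moreover have "runs w [Read 0 2] (?S4, out) (S (Suc i), out)"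
    proof -
      have "nat_of_string (take (Suc i) w) = 2 * nat_of_string (take i w) + input_digit w i"
        using i by (simp add: take_Suc_conv_app_nth nat_of_string_snoc input_digit_def)
      then have "?S4(2 := ?S4 2 + input_digit w (?S4 0)) = S (Suc i)"
        by (auto simp: S_def fun_eq_iff)
      then show ?thesis using runs_Read[of w 0 2 ?S4 out] by simp
    qed
    ultimately show "runs w ?body (S i, out) (S (Suc i), out)" by (intro runs_append)
  qed (auto simp: S_def input_digit_def)
  moreover have "runs w [While 0 [Dec 0]] (S (length w), out) ((S (length w))(0 := 0), out)"
    by (rule runs_clear)
  moreover have "runs w [While 1 [Dec 1, Inc 0]] ((S (length w))(0 := 0), out) ((\<lambda>_::nat. 0::nat)(0 := nat_of_string w), out)"
  proof -
    let ?T = "(S (length w))(0 := 0)"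
    have "?T(1 := 0, 0 := ?T 0 + ?T 1) = (\<lambda>_::nat. 0::nat)(0 := nat_of_string w)"
      by (auto simp: S_def fun_eq_iff input_digit_def)
    then show ?thesis using runs_move[of 1 0 w ?T out] by simp
  qed
  ultimately show ?thesis unfolding read_program_def by (intro runs_append)
qed

text \<open>
The digits of a number are obtained from the last to the first by repeated halving, which is the
order in which the output grows.
\<close>

lemma ex_print_program:
  "\<exists>c. \<forall>w x y out. runs w c ((\<lambda>_::nat. 0::nat)(0 := y, 1 := x), out) ((\<lambda>_::nat. 0::nat)(0 := y), string_of_nat x @ out)"
proof -
  have half: "computable 2 (\<lambda>s. (s 1 - 1) div 2)" and parity: "computable 2 (\<lambda>s. (s 1 - 1) mod 2)"
    by (intro computable_intros computable_register; simp)+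
  have id: "id r < (2::nat)" if "r < 2" for r using that by simp
  obtain ch where "\<forall>w s out. (\<forall>r\<ge>2. s r = 0) \<longrightarrow> runs w ch (s, out) (s(2 := (s 1 - 1) div 2), out)"
    using computable_program[of _ _ id 2, OF half id] unfolding id_apply ..
  note ch = this[rule_format]
  have id: "id r < (3::nat)" if "r < 2" for r using that by simp
  obtain cp where "\<forall>w s out. (\<forall>r\<ge>3. s r = 0) \<longrightarrow> runs w cp (s, out) (s(3 := (s 1 - 1) mod 2), out)"
    using computable_program[of _ _ id 3, OF parity id] unfolding id_apply ..
  note cp = this[rule_format]
  let ?body = "ch @ cp @ [Emit 3] @ [While 3 [Dec 3]] @ [While 1 [Dec 1]] @ [While 2 [Dec 2, Inc 1]]"
  have "runs w [While 1 ?body] ((\<lambda>_::nat. 0::nat)(0 := y, 1 := x), out) ((\<lambda>_::nat. 0::nat)(0 := y), string_of_nat x @ out)" for w x y out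
  proof (induction x arbitrary: out rule: string_of_nat.induct)
    case 1
    have "(\<lambda>_::nat. 0::nat)(0 := y, 1 := 0) = (\<lambda>_::nat. 0::nat)(0 := y)" by auto
    then show ?case
      unfolding string_of_nat.simps append_Nil by (simp only:) (rule runs_While_False, simp)
  next
    case (2 m)
    let ?s = "(\<lambda>_::nat. 0::nat)(0 := y, 1 := Suc m)"
    let ?s1 = "?s(2 := m div 2)"
    let ?s2 = "?s1(3 := m mod 2)"
    let ?s3 = "?s2(3 := 0)"
    let ?s4 = "?s3(1 := 0)"
    let ?s5 = "(\<lambda>_::nat. 0::nat)(0 := y, 1 := m div 2)"
    have "runs w ch (?s, out) (?s1, out)" using ch[of ?s w out] by simp
    moreover have "runs w cp (?s1, out) (?s2, out)" using cp[of ?s1 w out] by simp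
    moreover have "runs w [Emit 3] (?s2, out) (?s2, odd m # out)"
      using runs_Emit[of w 3 ?s2 out] by (simp add: odd_iff_mod_2_eq_one)
    moreover have "runs w [While 3 [Dec 3]] (?s2, odd m # out) (?s3, odd m # out)"
      by (rule runs_clear)
    moreover have "runs w [While 1 [Dec 1]] (?s3, odd m # out) (?s4, odd m # out)"
      by (rule runs_clear)
    moreover have "runs w [While 2 [Dec 2, Inc 1]] (?s4, odd m # out) (?s5, odd m # out)"
    proof -
      have "?s4(2 := 0, 1 := ?s4 1 + ?s4 2) = ?s5" by (auto simp: fun_eq_iff)
      then show ?thesis using runs_move[of 2 1 w ?s4 "odd m # out"] by simp
    qed
    ultimately have body: "runs w ?body (?s, out) (?s5, odd m # out)" by (intro runs_append)
    have digits: "string_of_nat (Suc m) @ out = string_of_nat (m div 2) @ odd m # out" by simp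
    show ?case
      unfolding digits by (rule runs_While_True[OF _ body 2]) simp
  qed
  then show ?thesis by blast
qed

text \<open>
The machine reads its whole input as one number, so that any decoding of the input, such as the
separation of a pair, can be left to arithmetic.
\<close>

theorem computable_to_tm:
  assumes "computable 1 f"
  shows "\<exists>M. \<forall>w. tm_fun M w = Some (string_of_nat (f (\<lambda>_. nat_of_string w)))"
proof -
  have id: "id r < (1::nat)" if "r < 1" for r using that by simp
  obtain cf where "\<forall>w s out. (\<forall>r\<ge>1. s r = 0) \<longrightarrow> runs w cf (s, out) (s(1 := f s), out)"
    using computable_program[of _ _ id 1, OF assms id] unfolding id_apply ..
  note cf = this[rule_format]
  obtain cw where cw: "runs w cw ((\<lambda>_::nat. 0::nat)(0 := y, 1 := x), out) ((\<lambda>_::nat. 0::nat)(0 := y), string_of_nat x @ out)" for w x y out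
    using ex_print_program by blast
  obtain M where M: "(prog_step w)\<^sup>*\<^sup>* (read_program @ cf @ cw, \<lambda>_. 0, []) ([], s, out) \<Longrightarrow> tm_fun M w = Some out" for w s out
    using program_to_tm by blast
  have "tm_fun M w = Some (string_of_nat (f (\<lambda>_. nat_of_string w)))" for w
  proof -
    let ?s = "(\<lambda>_::nat. 0::nat)(0 := nat_of_string w)"
    have "runs w (read_program @ cf @ cw) (\<lambda>_. 0, []) (?s, string_of_nat (f ?s) @ [])"
      by (rule runs_append[OF runs_read_program runs_append[OF cf cw]]) simp
    then have "(prog_step w)\<^sup>*\<^sup>* (read_program @ cf @ cw, \<lambda>_. 0, []) ([], ?s, string_of_nat (f ?s))"
      unfolding runs_def by (metis append_Nil2)
    moreover have "f ?s = f (\<lambda>_. nat_of_string w)"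
      by (rule computable_cong[OF assms]) simp
    ultimately show ?thesis using M by metis
  qed
  then show ?thesis by blast
qed

lemma nat_of_string_append:
  "nat_of_string (u @ v) = nat_of_string u * 2 ^ length v + nat_of_string v"
proof (induction v rule: rev_induct)
  case (snoc b v)
  then show ?case
    unfolding append_assoc[symmetric] nat_of_string_snoc by (simp add: algebra_simps)
qed simp

lemma nat_of_string_bounds:
  "2 ^ length w \<le> Suc (nat_of_string w)" "Suc (nat_of_string w) < 2 * 2 ^ length w"
  by (induction w rule: rev_induct) (auto simp: nat_of_string_snoc)

abbreviation string_length :: "nat \<Rightarrow> nat" where
  "string_length n \<equiv> length (string_of_nat n)"

lemma string_length_bounds:
  "2 ^ string_length n \<le> Suc n" "Suc n < 2 * 2 ^ string_length n"
  using nat_of_string_bounds[of "string_of_nat n"] by simp_all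

lemma computable_string_length [computable_intros]:
  assumes "computable m f"
  shows "computable m (\<lambda>s. string_length (f s))"
proof -
  have "computable m (\<lambda>s. \<Sum>k<f s. of_bool (2 ^ Suc k \<le> Suc (f s)))"
    by (intro computable_intros computable_weaken assms computable_register)
      (auto simp: computable_upd[OF assms])
  moreover have "(\<Sum>k<n. of_bool (2 ^ Suc k \<le> Suc n)) = string_length n" for n
  proof -
    have "2 ^ Suc k \<le> Suc n \<longleftrightarrow> k < string_length n" for k
    proof
      assume "2 ^ Suc k \<le> Suc n"
      then have "(2 :: nat) ^ Suc k < 2 ^ Suc (string_length n)"
        by (rule le_less_trans) (use string_length_bounds(2)[of n] in \<open>simp only: power_Suc\<close>)
      from power_less_imp_less_exp[OF _ this] show "k < string_length n" by simp
    next
      assume "k < string_length n"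
      then have "(2 :: nat) ^ Suc k \<le> 2 ^ string_length n" by (intro power_increasing) auto
      then show "2 ^ Suc k \<le> Suc n" using string_length_bounds(1)[of n] by linarith
    qed
    moreover have "string_length n \<le> n"
      by (induction n rule: string_of_nat.induct) auto
    then have "{k \<in> {..<n}. k < string_length n} = {..<string_length n}" by auto
    ultimately show ?thesis by (simp add: sum.If_cases of_bool_def Int_def)
  qed
  ultimately show ?thesis by simp
qed

lemma nat_of_string_replicate_True: "nat_of_string (replicate l True) = 2 * 2 ^ l - 2"
proof (induction l)
  case (Suc l)
  obtain k where "(2::nat) ^ l = Suc k" using not0_implies_Suc[of "2 ^ l"] by auto
  then show ?case
    unfolding replicate_append_same[symmetric] replicate_Suc nat_of_string_snoc Suc by simp
qed simp

section \<open>Complexity of the members of a decidable family\<close>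

definition pair_code :: "nat \<Rightarrow> nat \<Rightarrow> nat" where
  "pair_code p y = nat_of_string (string_pair (string_of_nat p) (string_of_nat y))"

lemma computable_pair_code [computable_intros]:
  assumes "computable m f" "computable m g"
  shows "computable m (\<lambda>s. pair_code (f s) (g s))"
proof -
  have "pair_code p y =
      ((4 * 2 ^ string_length p - 3) * 2 ^ string_length p + p) * 2 ^ string_length y + y" for p y
  proof -
    have "nat_of_string (replicate l True @ [False]) = 4 * 2 ^ l - 3" for l
    proof -
      obtain k where "(2::nat) ^ l = Suc k" using not0_implies_Suc[of "2 ^ l"] by auto
      then show ?thesis unfolding nat_of_string_snoc nat_of_string_replicate_True by simp
    qed
    moreover have "string_pair u v = ((replicate (length u) True @ [False]) @ u) @ v" for u v
      by (simp add: string_pair_def)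
    ultimately show ?thesis
      unfolding pair_code_def nat_of_string_append by (simp only: nat_of_string_append nat_of_string_of_nat)
  qed
  then show ?thesis by (simp only:) (intro computable_intros assms)
qed

lemma string_pair_inject:
  assumes "string_pair a b = string_pair c d"
  shows "a = c \<and> b = d"
proof -
  have tw: "takeWhile id (string_pair u v) = replicate (length u) True" for u v
    unfolding string_pair_def by (subst takeWhile_append2) auto
  have "replicate (length a) True = replicate (length c) True"
    using arg_cong[OF assms, of "takeWhile id"] unfolding tw .
  then have "length a = length c" by (metis length_replicate)
  then show ?thesis using assms unfolding string_pair_def by simp
qed

lemma pair_code_inject: "pair_code p y = pair_code q z \<longleftrightarrow> p = q \<and> y = z"
proof
  assume "pair_code p y = pair_code q z"
  then have "string_pair (string_of_nat p) (string_of_nat y) = string_pair (string_of_nat q) (string_of_nat z)"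
    unfolding pair_code_def by (metis string_of_nat_of_string)
  then show "p = q \<and> y = z"
    by (metis string_pair_inject nat_of_string_of_nat)
qed simp

lemma pair_code_ge: "p \<le> pair_code p y" "y \<le> pair_code p y"
proof -
  define a where "a = nat_of_string (replicate (string_length p) True @ [False]) * 2 ^ string_length p"
  have code: "pair_code p y = (a + p) * 2 ^ string_length y + y"
    unfolding pair_code_def string_pair_def append_assoc[symmetric] nat_of_string_append a_def
    by (simp add: nat_of_string_append)
  have "p \<le> (a + p) * 1" by simp
  also have "\<dots> \<le> (a + p) * 2 ^ string_length y" by (rule mult_le_mono2) simp
  finally show "p \<le> pair_code p y" unfolding code by (rule trans_le_add1)
  show "y \<le> pair_code p y" unfolding code by linarith
qed

text \<open>
The universal machine simulates \<open>M\<close> at the expense of a constant: naming \<open>M\<close> by an index \<open>i\<close> in the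
enumeration costs the self-delimiting code of \<open>i\<close>.
\<close>

lemma kolmogorov_invariance:
  assumes "universal_tm T U"
  shows "\<exists>c. \<forall>p y x. tm_fun M (string_pair p y) = Some x \<longrightarrow> kolmogorov U x y \<le> length p + c"
proof -
  obtain i where i: "T i = M" using assms unfolding universal_tm_def surj_def by metis
  have "kolmogorov U x y \<le> length p + (2 * string_length i + 1)" if "tm_fun M (string_pair p y) = Some x" for p y x
  proof -
    have "tm_fun U (string_pair (string_pair (string_of_nat i) p) y) = Some x"
      using assms that i unfolding universal_tm_def by metis
    then have "kolmogorov U x y \<le> length (string_pair (string_of_nat i) p)"
      unfolding kolmogorov_def by (intro Least_le) blast
    then show ?thesis by (simp add: string_pair_def)
  qed
  then show ?thesis by blast
qed

lemma enumeration_unique: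
  assumes "A (x::nat)" "A y" "card {z. z < x \<and> A z} = card {z. z < y \<and> A z}"
  shows "x = y"
proof -
  have "card {z. z < u \<and> A z} < card {z. z < v \<and> A z}" if "A u" "u < v" for u v
    by (rule psubset_card_mono) (use that in auto)
  then show ?thesis using assms by (metis linorder_neqE_nat less_irrefl)
qed

text \<open>
Given \<open>n\<close>, a member \<open>x\<close> of the family \<open>A n\<close> is determined by its rank, and a machine finds it by
searching below the computable bound \<open>B n\<close>.  Decidability is assumed in the form in which it is
derived and used, closed under substitution of computable functions.
\<close>

theorem kolmogorov_enumerated:
  assumes U: "universal_tm T U"
    and A: "\<And>m f g. computable m f \<Longrightarrow> computable m g \<Longrightarrow> decidable m (\<lambda>s. A (f s) (g s))"
    and B: "\<And>m f. computable m f \<Longrightarrow> computable m (\<lambda>s. B (f s))"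
    and bound: "\<And>n x. A n x \<Longrightarrow> x < B n"
  shows "\<exists>c. \<forall>n x. A n x \<longrightarrow>
    kolmogorov U (string_of_nat x) (string_of_nat n) \<le> string_length (card {z. z < x \<and> A n z}) + c"
proof -
  \<comment> \<open>The outer sums decode the input: if \<open>w\<close> is the code of a pair, only the summand of this pair survives.\<close>
  define F where "F w = (\<Sum>n<Suc w. \<Sum>p<Suc w. of_bool (pair_code p n = w) *
      (\<Sum>x<B n. of_bool (A n x \<and> (\<Sum>z<x. of_bool (A n z)) = p) * x))" for w
  have F: "F (pair_code (card {z. z < x \<and> A n z}) n) = x" if "A n x" for n x
  proof -
    define p where "p = card {z. z < x \<and> A n z}"
    have rank: "(\<Sum>z<y. of_bool (A n z)) = card {z. z < y \<and> A n z}" for y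
      by (simp add: sum.If_cases of_bool_def Int_def)
    have "of_bool (A n y \<and> (\<Sum>z<y. of_bool (A n z)) = p) * y = (if x = y then x else 0)" for y
      unfolding rank using enumeration_unique[of "A n" x y] that by (auto simp: p_def)
    then have inner: "(\<Sum>y<B n. of_bool (A n y \<and> (\<Sum>z<y. of_bool (A n z)) = p) * y) = x"
      using bound[OF that] by simp
    have summand: "of_bool (p' = p \<and> n' = n) *
        (\<Sum>x<B n'. of_bool (A n' x \<and> (\<Sum>z<x. of_bool (A n' z)) = p') * x) =
        (if n' = n then if p' = p then x else 0 else 0)" for n' p'
    proof (cases "p' = p \<and> n' = n")
      case True
      then have "p' = p" "n' = n" by auto
      then show ?thesis by (simp only: inner) simp
    qed auto
    have row: "(\<Sum>p'<Suc (pair_code p n). if n' = n then if p' = p then x else 0 else 0) =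
        (if n' = n then x else 0)" for n'
      using pair_code_ge(1)[of p n] by (cases "n' = n") (simp_all del: sum.lessThan_Suc)
    have "F (pair_code p n) = x"
      unfolding F_def pair_code_inject summand row
      using pair_code_ge(2)[of n p] by (simp del: sum.lessThan_Suc)
    then show ?thesis by (simp add: p_def)
  qed
  have "computable 1 (\<lambda>s. F (s 0))"
    unfolding F_def
    by (intro computable_intros A B computable_register; simp)
  then obtain M where M: "\<And>w. tm_fun M w = Some (string_of_nat (F (nat_of_string w)))"
    using computable_to_tm by blast
  obtain c where c: "\<And>p y x. tm_fun M (string_pair p y) = Some x \<Longrightarrow> kolmogorov U x y \<le> length p + c"
    using kolmogorov_invariance[OF U] by blast
  have "kolmogorov U (string_of_nat x) (string_of_nat n) \<le> string_length (card {z. z < x \<and> A n z}) + c"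
    if "A n x" for n x
    by (rule c) (use F[OF that] in \<open>simp add: M pair_code_def\<close>)
  then show ?thesis by blast
qed

section \<open>Graph strings as numbers\<close>

text \<open>
If \<open>x\<close> represents a string of length \<open>l\<close>, then \<open>Suc x\<close> has that string, preceded by the digit 1, as
its ordinary binary expansion.
\<close>

definition string_bit :: "nat \<Rightarrow> nat \<Rightarrow> nat \<Rightarrow> bool" where
  "string_bit l x t \<longleftrightarrow> Suc x div 2 ^ (l - 1 - t) mod 2 = 1"

lemma string_bit_nat_of_string:
  "t < length w \<Longrightarrow> string_bit (length w) (nat_of_string w) t \<longleftrightarrow> w ! t"
proof (induction w rule: rev_induct)
  case (snoc b w)
  show ?case
  proof (cases "t = length w")
    case True
    then show ?thesis by (simp add: string_bit_def nat_of_string_snoc nth_append mod2_eq_if)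
  next
    case False
    then have t: "t < length w" using snoc.prems by simp
    then have "length w - t = Suc (length w - 1 - t)" by simp
    moreover have "Suc (nat_of_string (w @ [b])) div 2 = Suc (nat_of_string w)"
      by (simp add: nat_of_string_snoc)
    ultimately have "string_bit (length (w @ [b])) (nat_of_string (w @ [b])) t =
        string_bit (length w) (nat_of_string w) t"
      unfolding string_bit_def by (simp add: div_mult2_eq)
    then show ?thesis using snoc.IH[OF t] t by (simp add: nth_append)
  qed
qed simp

text \<open>
The edges \<open>{a + 1, b}\<close> with \<open>b > a + 1\<close> form a block of length \<open>n - 1 - a\<close>.
\<close>

definition edge_index :: "nat \<Rightarrow> nat \<Rightarrow> nat \<Rightarrow> nat" where
  "edge_index n i j = (\<Sum>a<i - 1. n - 1 - a) + (j - i - 1)"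

lemma possible_edges_concat:
  "possible_edges n = concat (map (\<lambda>i. map (Pair i) [Suc i..<Suc n]) [1..<Suc n])"
  by (simp add: possible_edges_def)

lemma set_possible_edges: "set (possible_edges n) = {(i, j). 1 \<le> i \<and> i < j \<and> j \<le> n}"
  by (force simp: possible_edges_concat simp del: upt_Suc)

lemma distinct_possible_edges: "distinct (possible_edges n)"
proof -
  have "distinct (concat (map (\<lambda>i. map (Pair i) [Suc i..<Suc n]) xs))" if "distinct xs" for xs
    using that by (induction xs) (auto simp: distinct_map inj_on_def simp del: upt_Suc)
  then show ?thesis unfolding possible_edges_concat by simp
qed

lemma length_possible_edges: "length (possible_edges n) = n choose 2"
  using length_graph_string[of n "{}"] by (simp add: graph_string_def)

lemma nth_possible_edges:
  assumes "1 \<le> i" "i < j" "j \<le> n"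
  shows "edge_index n i j < n choose 2" "possible_edges n ! edge_index n i j = (i, j)"
proof -
  let ?rows = "\<lambda>xs. concat (map (\<lambda>i. map (Pair i) [Suc i..<Suc n]) xs)"
  have "length (?rows [1..<Suc k]) = (\<Sum>a<k. n - 1 - a)" for k
    by (induction k) (simp_all del: upt_Suc add: upt_Suc_append)
  from this[of "i - 1"] have len: "length (?rows [1..<i]) = (\<Sum>a<i - 1. n - 1 - a)"
    using assms by simp
  have "[1..<Suc n] = [1..<i] @ i # [Suc i..<Suc n]"
    using assms upt_add_eq_append[of 1 i "Suc n - i"] upt_conv_Cons[of i "Suc n"] by simp
  then have split: "possible_edges n = ?rows [1..<i] @ map (Pair i) [Suc i..<Suc n] @ ?rows [Suc i..<Suc n]"
    by (simp add: possible_edges_concat del: upt_Suc)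
  have "j - i - 1 < length (map (Pair i) [Suc i..<Suc n])" using assms by simp
  then show "edge_index n i j < n choose 2"
    unfolding length_possible_edges[symmetric] split edge_index_def len[symmetric] length_append by linarith
  show "possible_edges n ! edge_index n i j = (i, j)"
    unfolding split edge_index_def len[symmetric] nth_append_length_plus
    using assms \<open>j - i - 1 < _\<close> by (simp add: nth_append del: upt_Suc)
qed

lemma nth_graph_string:
  assumes "1 \<le> i" "i < j" "j \<le> n"
  shows "graph_string n E ! edge_index n i j \<longleftrightarrow> {i, j} \<in> E"
  using nth_possible_edges[OF assms] by (simp add: graph_string_def length_possible_edges)

lemma ex_graph_string:
  assumes "length w = n choose 2"
  shows "\<exists>E. labeled_graph n E \<and> graph_string n E = w"
proof -
  define E where "E = {{i, j} |i j. 1 \<le> i \<and> i < j \<and> j \<le> n \<and> w ! edge_index n i j}"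
  have "labeled_graph n E" 
    unfolding labeled_graph_def E_def by (auto simp: card_insert_if)
  moreover have "graph_string n E = w"
  proof (rule nth_equalityI)
    show "length (graph_string n E) = length w" by (simp add: length_graph_string assms)
    fix t assume "t < length (graph_string n E)"
    then have t: "t < length (possible_edges n)" by (simp add: graph_string_def)
    obtain i j where ij: "possible_edges n ! t = (i, j)" by fastforce
    then have range: "1 \<le> i" "i < j" "j \<le> n"
      using nth_mem[OF t] by (auto simp: set_possible_edges)
    have "edge_index n i j = t"
      using nth_possible_edges[OF range] ij t nth_eq_iff_index_eq[OF distinct_possible_edges]
      by (metis length_possible_edges)
    moreover have "{i, j} \<in> E \<longleftrightarrow> w ! edge_index n i j"
      using range by (auto simp: E_def doubleton_eq_iff)
    ultimately show "graph_string n E ! t = w ! t"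
      using nth_graph_string[OF range] by metis
  qed
  ultimately show ?thesis by blast
qed

definition adjacent_code :: "nat \<Rightarrow> nat \<Rightarrow> nat \<Rightarrow> nat \<Rightarrow> bool" where
  "adjacent_code n x i j \<longleftrightarrow>
     (i < j \<and> string_bit (n choose 2) x (edge_index n i j)) \<or>
     (j < i \<and> string_bit (n choose 2) x (edge_index n j i))"

lemma adjacent_code_graph_string:
  assumes "i \<in> {1..n}" "j \<in> {1..n}" "i \<noteq> j"
  shows "adjacent_code n (nat_of_string (graph_string n E)) i j \<longleftrightarrow> {i, j} \<in> E"
proof -
  have "string_bit (n choose 2) (nat_of_string (graph_string n E)) (edge_index n a b) \<longleftrightarrow> {a, b} \<in> E"
    if "1 \<le> a" "a < b" "b \<le> n" for a b
    using string_bit_nat_of_string[of "edge_index n a b" "graph_string n E"]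
      nth_possible_edges(1)[OF that] nth_graph_string[OF that]
    by (simp add: length_graph_string)
  then show ?thesis
    using assms by (cases i j rule: linorder_cases) (auto simp: adjacent_code_def insert_commute)
qed

definition two_paths_code :: "nat \<Rightarrow> nat \<Rightarrow> nat \<Rightarrow> nat \<Rightarrow> nat" where
  "two_paths_code n x i j =
     (\<Sum>k<Suc n. of_bool (0 < k \<and> k \<noteq> i \<and> k \<noteq> j \<and> adjacent_code n x i k \<and> adjacent_code n x k j))"

lemma two_paths_code_graph_string:
  assumes "i \<in> {1..n}" "j \<in> {1..n}" "i \<noteq> j"
  shows "two_paths_code n (nat_of_string (graph_string n E)) i j = num_two_paths n E i j"
proof -
  have "{..<Suc n} \<inter> {k. 0 < k \<and> k \<noteq> i \<and> k \<noteq> j \<and>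
        adjacent_code n (nat_of_string (graph_string n E)) i k \<and>
        adjacent_code n (nat_of_string (graph_string n E)) k j} =
      {k \<in> {1..n}. k \<noteq> i \<and> k \<noteq> j \<and> {i, k} \<in> E \<and> {k, j} \<in> E}"
    using assms adjacent_code_graph_string[of _ n _ E] by (auto simp: less_Suc_eq_le)
  then show ?thesis
    unfolding two_paths_code_def num_two_paths_def
    by (simp add: of_bool_def sum.If_cases del: sum.lessThan_Suc)
qed

text \<open>
The comparison \<open>\<bar>r - n/4\<bar> \<ge> n/m\<close> of \<open>deviates_iff\<close> in terms of natural numbers.  A truncated
difference is 0 and does not trigger its disjunct if \<open>n > 0\<close>.
\<close>

definition deviates :: "nat \<Rightarrow> nat \<Rightarrow> nat \<Rightarrow> bool" where
  "deviates m n r \<longleftrightarrow> 4 * n \<le> m * (4 * r - n) \<or> 4 * n \<le> m * (n - 4 * r)"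

lemma deviates_iff:
  assumes "m > 0" "n > 0"
  shows "deviates m n r \<longleftrightarrow> real n / real m \<le> \<bar>real r - real n / 4\<bar>"
proof -
  have nat: "4 * n \<le> m * (a - b) \<longleftrightarrow> 4 * real n \<le> real m * (real a - real b)" for a b
  proof (cases "b \<le> a")
    case True
    have "4 * n \<le> m * (a - b) \<longleftrightarrow> real (4 * n) \<le> real (m * (a - b))"
      by (simp only: of_nat_le_iff)
    then show ?thesis using True by (simp add: of_nat_diff)
  next
    case False
    then have "real m * (real a - real b) \<le> 0" by (intro mult_nonneg_nonpos) auto
    then show ?thesis using False assms by auto
  qed
  have "deviates m n r \<longleftrightarrow> real n / real m \<le> real r - real n / 4 \<or> real n / real m \<le> real n / 4 - real r"
    unfolding deviates_def nat using assms by (simp add: field_simps)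
  then show ?thesis by linarith
qed

definition deviant :: "nat \<Rightarrow> nat \<Rightarrow> nat set set \<Rightarrow> bool" where
  "deviant m n E \<longleftrightarrow> (\<exists>i\<in>{1..n}. \<exists>j\<in>{1..n}. i < j \<and> deviates m n (num_two_paths n E i j))"

text \<open>
The first two conjuncts single out the numbers whose strings have length \<open>n choose 2\<close>.
\<close>

definition deviant_code :: "nat \<Rightarrow> nat \<Rightarrow> nat \<Rightarrow> bool" where
  "deviant_code m n x \<longleftrightarrow> 2 ^ (n choose 2) \<le> Suc x \<and> Suc x < 2 * 2 ^ (n choose 2) \<and>
     (\<exists>i<Suc n. \<exists>j<Suc n. 0 < i \<and> i < j \<and> deviates m n (two_paths_code n x i j))"

lemma deviant_code_graph_string:
  "deviant_code m n (nat_of_string (graph_string n E)) \<longleftrightarrow> deviant m n E"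
proof -
  have "(\<exists>i<Suc n. \<exists>j<Suc n. 0 < i \<and> i < j \<and>
      deviates m n (two_paths_code n (nat_of_string (graph_string n E)) i j)) \<longleftrightarrow> deviant m n E"
  proof -
    have "0 < i \<and> i < j \<and> deviates m n (two_paths_code n (nat_of_string (graph_string n E)) i j) \<longleftrightarrow>
        i \<in> {1..n} \<and> j \<in> {1..n} \<and> i < j \<and> deviates m n (num_two_paths n E i j)"
      if "i < Suc n" "j < Suc n" for i j
      using that two_paths_code_graph_string[of i n j E] by (cases "0 < i \<and> i < j") auto
    moreover have "i < Suc n" if "i \<in> {1..n}" for i using that by simp
    ultimately show ?thesis unfolding deviant_def by blast
  qed
  then show ?thesis
    unfolding deviant_code_def
    using nat_of_string_bounds[of "graph_string n E"] by (simp add: length_graph_string)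
qed

text \<open>
Every number that passes the test comes from a graph.  Hence the number of graphs bounds the rank in
the enumeration.
\<close>

lemma deviant_code_imp_graph:
  assumes "deviant_code m n x"
  shows "\<exists>E. labeled_graph n E \<and> deviant m n E \<and> x = nat_of_string (graph_string n E)"
proof -
  have "string_length x = n choose 2"
  proof -
    let ?l = "string_length x"
    have "(2::nat) ^ ?l < 2 ^ Suc (n choose 2)"
      using string_length_bounds[of x] assms unfolding deviant_code_def power_Suc by linarith
    moreover have "(2::nat) ^ (n choose 2) < 2 ^ Suc ?l"
      using string_length_bounds[of x] assms unfolding deviant_code_def power_Suc by linarith
    ultimately show ?thesis
      by (intro antisym) (auto dest!: power_less_imp_less_exp[rotated] simp del: power_Suc)
  qed
  then obtain E where "labeled_graph n E" "graph_string n E = string_of_nat x"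
    using ex_graph_string by blast
  then show ?thesis
    using assms deviant_code_graph_string[of m n E] by auto
qed

lemma computable_edge_index [computable_intros]:
  assumes "computable m f" "computable m g" "computable m h"
  shows "computable m (\<lambda>s. edge_index (f s) (g s) (h s))"
  unfolding edge_index_def
  by (intro computable_intros computable_weaken assms computable_register)
    (simp_all add: computable_upd[OF assms(1)])

lemma computable_choose_two [computable_intros]:
  assumes "computable m f"
  shows "computable m (\<lambda>s. f s choose 2)"
  unfolding choose_two by (intro computable_intros assms)

lemma decidable_adjacent_code [computable_intros]:
  assumes "computable m f" "computable m g" "computable m h" "computable m h'"
  shows "decidable m (\<lambda>s. adjacent_code (f s) (g s) (h s) (h' s))"
  unfolding adjacent_code_def string_bit_def
  by (intro computable_intros assms)

lemma computable_two_paths_code [computable_intros]: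
  assumes "computable m f" "computable m g" "computable m h" "computable m h'"
  shows "computable m (\<lambda>s. two_paths_code (f s) (g s) (h s) (h' s))"
  unfolding two_paths_code_def
  by (intro computable_intros computable_weaken assms computable_register)
    (simp_all add: assms[THEN computable_upd(1)])

lemma decidable_deviant_code [computable_intros]:
  assumes "computable m f" "computable m g"
  shows "decidable m (\<lambda>s. deviant_code d (f s) (g s))"
proof -
  note upd = assms[THEN computable_upd(1)] assms[THEN computable_weaken(1), THEN computable_upd(1)]
  have deviates: "decidable k (\<lambda>s. deviates d (u s) (v s))" if "computable k u" "computable k v" for k u v
    unfolding deviates_def by (intro computable_intros that)
  have pair: "decidable (Suc (Suc m)) (\<lambda>s. 0 < s m \<and> s m < s (Suc m) \<and>
      deviates d (f s) (two_paths_code (f s) (g s) (s m) (s (Suc m))))"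
    by (intro decidable_conj decidable_less computable_const deviates computable_two_paths_code
      assms[THEN computable_weaken(2)] computable_register) simp_all
  have row: "decidable (Suc m) (\<lambda>s. \<exists>j<Suc (f s). 0 < s m \<and> s m < j \<and>
      deviates d (f s) (two_paths_code (f s) (g s) (s m) j))"
    by (rule decidable_ex[OF computable_Suc[OF computable_weaken(1)[OF assms(1)]]], rule pair)
      (simp add: upd)
  have pairs: "decidable m (\<lambda>s. \<exists>i<Suc (f s). \<exists>j<Suc (f s). 0 < i \<and> i < j \<and>
      deviates d (f s) (two_paths_code (f s) (g s) i j))"
    by (rule decidable_ex[OF computable_Suc[OF assms(1)]], rule row) (simp add: upd)
  have "decidable m (\<lambda>s. 2 ^ (f s choose 2) \<le> Suc (g s))"
    "decidable m (\<lambda>s. Suc (g s) < 2 * 2 ^ (f s choose 2))"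
    by (intro computable_intros assms)+
  from decidable_conj[OF this(1) decidable_conj[OF this(2) pairs]] show ?thesis
    unfolding deviant_code_def .
qed

section \<open>Counting deviant graphs\<close>

lemma sum_Pow_insert:
  assumes "finite X" "a \<notin> X"
  shows "(\<Sum>E\<in>Pow (insert a X). f E) = (\<Sum>E\<in>Pow X. f E + f (insert a E))"
proof -
  have "inj_on (insert a) (Pow X)" using assms(2) by (auto simp: inj_on_def)
  moreover have "Pow X \<inter> insert a ` Pow X = {}" using assms(2) by auto
  ultimately show ?thesis
    unfolding Pow_insert using assms(1) by (simp add: sum.union_disjoint sum.reindex sum.distrib)
qed

text \<open>
The pairs of potential edges \<open>{i, k}\<close>, \<open>{k, j}\<close> are disjoint for different \<open>k\<close>, so the sum factorizes.
Each \<open>k\<close> contributes 3 for the edge sets that miss one of its two edges and \<open>z\<close> for the one that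
contains both; each edge of \<open>B\<close> contributes 2.
\<close>

lemma common_neighbour_moment:
  fixes z :: real
  assumes "finite K" "i \<notin> K" "j \<notin> K" "i \<noteq> j" "finite B"
    and "B \<inter> (\<Union>k\<in>K. {{i, k}, {k, j}}) = {}"
  shows "(\<Sum>E\<in>Pow (B \<union> (\<Union>k\<in>K. {{i, k}, {k, j}})). z ^ card {k \<in> K. {i, k} \<in> E \<and> {k, j} \<in> E})
    = 2 ^ card B * (3 + z) ^ card K"
  using assms
proof (induction K rule: finite_induct)
  case empty
  then show ?case by (simp add: card_Pow)
next
  case (insert k K)
  define X where "X = B \<union> (\<Union>k\<in>K. {{i, k}, {k, j}})"
  define c where "c L E = card {k \<in> L. {i, k} \<in> E \<and> {k, j} \<in> E}" for L E
  have finX: "finite X" using insert.hyps insert.prems by (auto simp: X_def)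
  have a: "{i, k} \<notin> X" and b: "{k, j} \<notin> X" and ab: "{i, k} \<noteq> {k, j}"
    using insert.hyps insert.prems by (auto simp: X_def doubleton_eq_iff)
  have c: "c (insert k K) E = c K E" "c (insert k K) (insert {i, k} E) = c K E"
      "c (insert k K) (insert {k, j} E) = c K E"
      "c (insert k K) (insert {i, k} (insert {k, j} E)) = Suc (c K E)" if "E \<subseteq> X" for E
  proof -
    have E: "{i, k} \<notin> E" "{k, j} \<notin> E" using that a b by auto
    have new: "{i, l} \<noteq> {i, k}" "{i, l} \<noteq> {k, j}" "{l, j} \<noteq> {i, k}" "{l, j} \<noteq> {k, j}" if "l \<in> K" for l
      using that insert.hyps insert.prems by (auto simp: doubleton_eq_iff)
    show "c (insert k K) E = c K E" "c (insert k K) (insert {i, k} E) = c K E"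
      "c (insert k K) (insert {k, j} E) = c K E"
      using E ab new unfolding c_def by (auto intro!: arg_cong[of _ _ card])
    have "{l \<in> insert k K. {i, l} \<in> insert {i, k} (insert {k, j} E) \<and> {l, j} \<in> insert {i, k} (insert {k, j} E)} =
        insert k {l \<in> K. {i, l} \<in> E \<and> {l, j} \<in> E}"
      using new by auto
    then show "c (insert k K) (insert {i, k} (insert {k, j} E)) = Suc (c K E)"
      using insert.hyps unfolding c_def by simp
  qed
  have "B \<union> (\<Union>k\<in>insert k K. {{i, k}, {k, j}}) = insert {i, k} (insert {k, j} X)"
    by (auto simp: X_def)
  then have "(\<Sum>E\<in>Pow (B \<union> (\<Union>k\<in>insert k K. {{i, k}, {k, j}})). z ^ c (insert k K) E) =
      (\<Sum>E\<in>Pow X. z ^ c (insert k K) E + z ^ c (insert k K) (insert {i, k} E) +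
        (z ^ c (insert k K) (insert {k, j} E) + z ^ c (insert k K) (insert {i, k} (insert {k, j} E))))"
    using finX a b ab by (simp add: sum_Pow_insert insert_commute)
  also have "\<dots> = (\<Sum>E\<in>Pow X. (3 + z) * z ^ c K E)"
    using c by (intro sum.cong) (auto simp: algebra_simps)
  also have "\<dots> = (3 + z) * (2 ^ card B * (3 + z) ^ card K)"
    using insert.IH insert.prems by (simp add: X_def c_def sum_distrib_left[symmetric] Int_Un_distrib)
  finally show ?case using insert.hyps by (simp add: c_def)
qed

text \<open>
Up to the normalization \<open>2 ^ (n choose 2)\<close> this is the generating function of a binomial distribution
with \<open>n - 2\<close> trials of success probability \<open>1/4\<close>.
\<close>

lemma two_path_moment:
  fixes z :: real
  assumes "i \<in> {1..n}" "j \<in> {1..n}" "i \<noteq> j"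
  shows "(\<Sum>E | labeled_graph n E. z ^ num_two_paths n E i j) = 2 ^ (n choose 2) * ((3 + z) / 4) ^ (n - 2)"
proof -
  let ?P = "{e. e \<subseteq> {1..n} \<and> card e = 2}"
  define K where "K = {1..n} - {i, j}"
  define B where "B = ?P - (\<Union>k\<in>K. {{i, k}, {k, j}})"
  have finP: "finite ?P" by (rule finite_subset[of _ "Pow {1..n}"]) auto
  have "{i, k} \<in> ?P \<and> {k, j} \<in> ?P" if "k \<in> K" for k
    using that assms by (auto simp: K_def card_insert_if)
  then have P: "?P = B \<union> (\<Union>k\<in>K. {{i, k}, {k, j}})" unfolding B_def by auto
  have disj: "B \<inter> (\<Union>k\<in>K. {{i, k}, {k, j}}) = {}" unfolding B_def by blast
  have finB: "finite B" unfolding B_def using finP by (rule finite_Diff)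
  have cardK: "card K = n - 2" using assms by (simp add: K_def card_Diff_subset)
  have moment: "(\<Sum>E\<in>Pow ?P. y ^ num_two_paths n E i j) = 2 ^ card B * (3 + y) ^ (n - 2)" for y :: real
  proof -
    have count: "num_two_paths n E i j = card {k \<in> K. {i, k} \<in> E \<and> {k, j} \<in> E}" for E
      unfolding num_two_paths_def K_def by (rule arg_cong[of _ _ card]) auto
    show ?thesis
      unfolding P cardK[symmetric] count
      by (rule common_neighbour_moment[OF _ _ _ assms(3) finB disj]) (simp_all add: K_def)
  qed
  have "card ?P = n choose 2" using n_subsets[of "{1..n}" 2] by simp
  \<comment> \<open>The case \<open>z = 1\<close> counts all graphs and so determines the number of edges outside the pairs.\<close>
  moreover have "real (card (Pow ?P)) = 2 ^ card B * 4 ^ (n - 2)" using moment[of 1] by simp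
  ultimately have total: "2 ^ (n choose 2) = (2 :: real) ^ card B * 4 ^ (n - 2)"
    using card_Pow[OF finP] by simp
  have "{E. labeled_graph n E} = Pow ?P" by (auto simp: labeled_graph_def)
  then show ?thesis unfolding total power_divide using moment[of z] by simp
qed

lemma exp_le_quadratic:
  fixes x :: real
  assumes "x \<le> 1"
  shows "exp x \<le> 1 + x + x\<^sup>2"
proof (cases "0 \<le> x")
  case True
  then show ?thesis using assms by (intro exp_bound)
next
  case False
  define y where "y = - x"
  have y: "y > 0" using False by (simp add: y_def)
  have "exp x = 1 / exp y" by (simp add: y_def exp_minus divide_inverse)
  also have "\<dots> \<le> 1 / (1 + y)" using y exp_ge_add_one_self[of y] by (intro divide_left_mono) auto
  also have "\<dots> \<le> 1 - y + y\<^sup>2"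
  proof -
    have "(1 - y + y\<^sup>2) * (1 + y) = 1 + y ^ 3"
      by (simp add: algebra_simps power2_eq_square power3_eq_cube)
    moreover have "0 \<le> y ^ 3" using y by simp
    ultimately have "1 \<le> (1 - y + y\<^sup>2) * (1 + y)" by linarith
    then show ?thesis using y by (subst pos_divide_le_eq) auto
  qed
  finally show ?thesis by (simp add: y_def)
qed

text \<open>
Markov's inequality for \<open>exp (l * r)\<close>.  A positive \<open>l\<close> gives the upper tail and a negative \<open>l\<close> the lower
one, with thresholds at distance \<open>\<bar>l\<bar> n / 2\<close> from \<open>n / 4\<close>.  The summand 1 in the exponent makes up for
the difference between \<open>n - 2\<close> trials and the threshold in terms of \<open>n\<close>.
\<close>

lemma two_path_tail:
  fixes l :: real
  assumes "i \<in> {1..n}" "j \<in> {1..n}" "i \<noteq> j" "l \<le> 1"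
  shows "real (card {E. labeled_graph n E \<and> l * (n / 4 + l / 2 * n) \<le> l * num_two_paths n E i j})
    \<le> 2 ^ (n choose 2) * exp (1 - l\<^sup>2 / 4 * n)"
proof -
  let ?G = "{E. labeled_graph n E}" and ?t = "l * (n / 4 + l / 2 * n)"
  let ?A = "{E. labeled_graph n E \<and> ?t \<le> l * num_two_paths n E i j}"
  have fin: "finite ?G"
    unfolding labeled_graph_def by (rule finite_subset[of _ "Pow (Pow {1..n})"]) auto
  have n: "2 \<le> n" using assms by (cases "n = 1") auto
  have "real (card ?A) = (\<Sum>E\<in>?A. 1)" by simp
  also have "\<dots> \<le> (\<Sum>E\<in>?A. exp (l * num_two_paths n E i j - ?t))"
    by (intro sum_mono) auto
  also have "\<dots> \<le> (\<Sum>E\<in>?G. exp (l * num_two_paths n E i j - ?t))"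
    using fin by (intro sum_mono2) auto
  also have "\<dots> = (\<Sum>E\<in>?G. exp l ^ num_two_paths n E i j) * exp (- ?t)"
  proof -
    have "exp (l * real r - ?t) = exp l ^ r * exp (- ?t)" for r :: nat
      by (simp only: diff_conv_add_uminus exp_add exp_of_nat_mult mult.commute[of l])
    then show ?thesis unfolding sum_distrib_right by (intro sum.cong) auto
  qed
  also have "\<dots> = 2 ^ (n choose 2) * ((3 + exp l) / 4) ^ (n - 2) * exp (- ?t)"
    using two_path_moment[OF assms(1-3)] by simp
  also have "\<dots> \<le> 2 ^ (n choose 2) * exp (real (n - 2) * (l / 4 + l\<^sup>2 / 4)) * exp (- ?t)"
  proof -
    have "(3 + exp l) / 4 \<le> 1 + (l / 4 + l\<^sup>2 / 4)" using exp_le_quadratic[OF assms(4)] by simp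
    also have "\<dots> \<le> exp (l / 4 + l\<^sup>2 / 4)" by (rule exp_ge_add_one_self)
    finally have "(3 + exp l) / 4 \<le> exp (l / 4 + l\<^sup>2 / 4)" .
    moreover have "0 \<le> (3 + exp l) / 4" by (simp add: add_nonneg_nonneg)
    ultimately have "((3 + exp l) / 4) ^ (n - 2) \<le> exp (real (n - 2) * (l / 4 + l\<^sup>2 / 4))"
      unfolding exp_of_nat_mult by (rule power_mono)
    then show ?thesis by (intro mult_right_mono mult_left_mono) auto
  qed
  also have "\<dots> = 2 ^ (n choose 2) * exp (real (n - 2) * (l / 4 + l\<^sup>2 / 4) - ?t)"
    by (simp only: diff_conv_add_uminus exp_add mult.assoc)
  also have "\<dots> \<le> 2 ^ (n choose 2) * exp (1 - l\<^sup>2 / 4 * n)"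
  proof -
    have "real (n - 2) = real n - 2" using n by (simp add: of_nat_diff)
    then have "1 - l\<^sup>2 / 4 * n - (real (n - 2) * (l / 4 + l\<^sup>2 / 4) - ?t) = ((l + 1 / 2)\<^sup>2 + 7 / 4) / 2"
      by (simp add: field_simps power2_eq_square)
    moreover have "0 \<le> ((l + 1 / 2)\<^sup>2 + 7 / 4) / 2" by simp
    ultimately have "real (n - 2) * (l / 4 + l\<^sup>2 / 4) - ?t \<le> 1 - l\<^sup>2 / 4 * n" by linarith
    then show ?thesis by (intro mult_left_mono) auto
  qed
  finally show ?thesis .
qed

lemma card_deviant_le:
  assumes "2 \<le> m" "0 < n"
  shows "real (card {E. labeled_graph n E \<and> deviant m n E}) \<le>
    real n ^ 2 * (2 * (2 ^ (n choose 2) * exp (1 - n / real m ^ 2)))"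
proof -
  let ?b = "2 ^ (n choose 2) * exp (1 - n / real m ^ 2)"
  define A where "A l i j = {E. labeled_graph n E \<and> l * (n / 4 + l / 2 * n) \<le> l * num_two_paths n E i j}"
    for l :: real and i j
  \<comment> \<open>Deviation \<open>n / m\<close> corresponds to the parameters \<open>2 / m\<close> and \<open>- 2 / m\<close> of the tail bound.\<close>
  define R where "R = {(i, j). i \<in> {1..n} \<and> j \<in> {1..n} \<and> i \<noteq> j}"
  define C where "C = (\<lambda>(i, j). A (2 / m) i j \<union> A (- 2 / m) i j)"
  have finR: "finite R" by (rule finite_subset[of _ "{1..n} \<times> {1..n}"]) (auto simp: R_def)
  have finG: "finite {E. labeled_graph n E}"
    unfolding labeled_graph_def by (rule finite_subset[of _ "Pow (Pow {1..n})"]) auto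
  have finA: "finite (A l i j)" for l i j
    by (rule finite_subset[OF _ finG]) (auto simp: A_def)
  have "card R \<le> card ({1..n} \<times> {1..n})" by (rule card_mono) (auto simp: R_def)
  then have cardR: "real (card R) \<le> real n ^ 2"
    by (simp add: power2_eq_square flip: of_nat_mult)
  have C: "real (card (C p)) \<le> 2 * ?b" if "p \<in> R" for p
  proof -
    obtain i j where p: "p = (i, j)" by force
    have "real (card (A l i j)) \<le> ?b" if "l = 2 / m \<or> l = - 2 / m" for l
    proof -
      have "0 \<le> 2 / real m" "2 / real m \<le> 1" using assms(1) by simp_all
      moreover have "- 2 / real m = - (2 / real m)" by simp
      ultimately have "l \<le> 1" using that by linarith
      moreover have "l\<^sup>2 / 4 * n = n / real m ^ 2" using that by (auto simp: power_divide)
      ultimately show ?thesis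
        using two_path_tail[of i n j l] \<open>p \<in> R\<close> p by (simp add: A_def R_def)
    qed
    from this[of "2 / m"] this[of "- 2 / m"] show ?thesis
      using card_Un_le[of "A (2 / m) i j" "A (- 2 / m) i j"] by (simp add: C_def p)
  qed
  have "{E. labeled_graph n E \<and> deviant m n E} \<subseteq> (\<Union>p\<in>R. C p)"
  proof
    fix E assume "E \<in> {E. labeled_graph n E \<and> deviant m n E}"
    then obtain i j where E: "labeled_graph n E" and range: "i \<in> {1..n}" "j \<in> {1..n}" "i < j"
      and dev: "deviates m n (num_two_paths n E i j)"
      unfolding deviant_def by blast
    then have ij: "(i, j) \<in> R" by (simp add: R_def)
    let ?r = "real (num_two_paths n E i j)"
    have m: "0 < real m" using assms by simp
    have "real n / m \<le> \<bar>?r - n / 4\<bar>" using dev assms by (simp add: deviates_iff)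
    then consider "n / 4 + n / m \<le> ?r" | "?r \<le> n / 4 - n / m" by linarith
    then have "E \<in> C (i, j)"
    proof cases
      case 1
      then have "(2 / m) * (n / 4 + (2 / m) / 2 * n) \<le> (2 / m) * ?r"
        by (intro mult_left_mono) auto
      then show ?thesis using E by (simp add: C_def A_def)
    next
      case 2
      then have "(- 2 / m) * (n / 4 + (- 2 / m) / 2 * n) \<le> (- 2 / m) * ?r"
        using m by (intro mult_left_mono_neg) auto
      then show ?thesis using E by (simp add: C_def A_def)
    qed
    then show "E \<in> (\<Union>p\<in>R. C p)" using ij by blast
  qed
  then have "card {E. labeled_graph n E \<and> deviant m n E} \<le> card (\<Union>p\<in>R. C p)"
    using finR finA by (intro card_mono) (auto simp: C_def)
  also have "\<dots> \<le> (\<Sum>p\<in>R. card (C p))" by (rule card_UN_le[OF finR])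
  finally have "real (card {E. labeled_graph n E \<and> deviant m n E}) \<le> (\<Sum>p\<in>R. real (card (C p)))"
    by (simp flip: of_nat_sum)
  also have "\<dots> \<le> real (card R) * (2 * ?b)" using C by (rule sum_bounded_above)
  also have "\<dots> \<le> real n ^ 2 * (2 * ?b)" using cardR by (intro mult_right_mono) auto
  finally show ?thesis .
qed

section \<open>Random graphs are not deviant\<close>

text \<open>
The rank \<open>q\<close> of a deviant graph is less than the number of deviant graphs, and the string of \<open>q\<close> has
at most \<open>log\<^sub>2 (q + 1)\<close> bits.
\<close>

lemma kolmogorov_deviant_le:
  assumes U: "universal_tm T U" and m: "2 \<le> m"
  shows "\<exists>c::nat. \<forall>n>0. \<forall>E. labeled_graph n E \<longrightarrow> deviant m n E \<longrightarrow>
    (real (kolmogorov U (graph_string n E) (string_of_nat n)) - c) * ln 2 \<le>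
      (n choose 2) * ln 2 + ln 2 + 2 * ln n + 1 - n / real m ^ 2"
proof -
  have "\<exists>c. \<forall>n x. deviant_code m n x \<longrightarrow>
    kolmogorov U (string_of_nat x) (string_of_nat n) \<le> string_length (card {z. z < x \<and> deviant_code m n z}) + c"
    by (rule kolmogorov_enumerated[OF U, where B = "\<lambda>n. 2 * 2 ^ (n choose 2)"])
      (intro computable_intros; assumption | simp add: deviant_code_def)+
  then obtain c where c: "\<And>n x. deviant_code m n x \<Longrightarrow>
    kolmogorov U (string_of_nat x) (string_of_nat n) \<le> string_length (card {z. z < x \<and> deviant_code m n z}) + c"
    by blast
  have "(real (kolmogorov U (graph_string n E) (string_of_nat n)) - c) * ln 2 \<le>
      (n choose 2) * ln 2 + ln 2 + 2 * ln n + 1 - n / real m ^ 2"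
    if n: "0 < n" and E: "labeled_graph n E" "deviant m n E" for n E
  proof -
    let ?D = "{E. labeled_graph n E \<and> deviant m n E}"
    define x where "x = nat_of_string (graph_string n E)"
    define q where "q = card {z. z < x \<and> deviant_code m n z}"
    have x: "deviant_code m n x" using E deviant_code_graph_string by (simp add: x_def)
    have finG: "finite ?D"
      by (rule finite_subset[of _ "Pow (Pow {1..n})"]) (auto simp: labeled_graph_def)
    have sub: "{z. deviant_code m n z} \<subseteq> (\<lambda>E. nat_of_string (graph_string n E)) ` ?D"
      using deviant_code_imp_graph by fastforce
    have "q < card {z. deviant_code m n z}"
      unfolding q_def using x finite_subset[OF sub] finG by (intro psubset_card_mono) auto
    also have "\<dots> \<le> card ?D"
      using card_mono[OF finite_imageI[OF finG] sub] card_image_le[OF finG] by (rule le_trans)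
    finally have q: "Suc q \<le> card ?D" by simp
    have "2 ^ string_length q \<le> card ?D" using string_length_bounds(1)[of q] q by linarith
    then have "(2::real) ^ string_length q \<le> real (card ?D)"
      by (metis of_nat_le_iff of_nat_numeral of_nat_power)
    also have "\<dots> \<le> real n ^ 2 * (2 * (2 ^ (n choose 2) * exp (1 - n / real m ^ 2)))"
      by (rule card_deviant_le[OF m n])
    finally have "ln (2 ^ string_length q) \<le> ln (real n ^ 2 * (2 * (2 ^ (n choose 2) * exp (1 - n / real m ^ 2))))"
      using n by (subst ln_le_cancel_iff) auto
    then have ln: "string_length q * ln 2 \<le> (n choose 2) * ln 2 + ln 2 + 2 * ln n + 1 - n / real m ^ 2"
      using n by (simp add: ln_mult ln_realpow algebra_simps)
    have "kolmogorov U (graph_string n E) (string_of_nat n) \<le> string_length q + c"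
      using c[OF x] by (simp add: q_def x_def)
    then have "real (kolmogorov U (graph_string n E) (string_of_nat n)) - c \<le> string_length q" by linarith
    then have "(real (kolmogorov U (graph_string n E) (string_of_nat n)) - c) * ln 2 \<le> string_length q * ln 2"
      by (intro mult_right_mono) auto
    then show ?thesis using ln by linarith
  qed
  then show ?thesis by blast
qed

theorem eventually_not_deviant:
  assumes U: "universal_tm T U" and m: "2 \<le> m" and \<delta>: "\<delta> \<in> o(\<lambda>n. real n)"
  shows "\<forall>\<^sub>F n in sequentially. \<forall>E. random_graph U (\<delta> n) n E \<longrightarrow> \<not> deviant m n E"
proof -
  obtain c :: nat where c: "\<And>n E. 0 < n \<Longrightarrow> labeled_graph n E \<Longrightarrow> deviant m n E \<Longrightarrow>
    (real (kolmogorov U (graph_string n E) (string_of_nat n)) - c) * ln 2 \<le>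
      (n choose 2) * ln 2 + ln 2 + 2 * ln n + 1 - n / real m ^ 2"
    using kolmogorov_deviant_le[OF U m] by blast
  define a where "a = 1 / (2 * real m ^ 2)"
  have a: "0 < a" using m by (simp add: a_def)
  have "\<forall>\<^sub>F n in sequentially. \<bar>\<delta> n\<bar> \<le> a * real n"
    using landau_o.smallD[OF \<delta> a] by simp
  moreover have "\<forall>\<^sub>F n in sequentially. c + 2 + 2 * ln (real n) < a * real n"
  proof -
    have "(\<lambda>n. (c + 2) / real n + 2 * (ln (real n) / real n)) \<longlonglongrightarrow> 0 + 2 * 0"
      by (intro tendsto_intros lim_const_over_n
          filterlim_compose[OF ln_x_over_x_tendsto_0 filterlim_real_sequentially])
    then have "\<forall>\<^sub>F n in sequentially. (c + 2) / real n + 2 * (ln (real n) / real n) < a"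
      using a by (intro order_tendstoD(2)) auto
    then show ?thesis
      using eventually_gt_at_top[of 0]
    proof eventually_elim
      case (elim n)
      have "(c + 2 + 2 * ln (real n)) / real n < a" using elim(1) by (simp add: add_divide_distrib)
      then show ?case using elim(2) by (simp add: pos_divide_less_eq)
    qed
  qed
  ultimately show ?thesis
    using eventually_gt_at_top[of 0]
  proof eventually_elim
    case (elim n)
    have False if "random_graph U (\<delta> n) n E" "deviant m n E" for E
    proof -
      have ln2: "0 < ln (2::real)" "ln (2::real) \<le> 1" using ln_le_minus_one[of "2::real"] by auto
      have E: "labeled_graph n E" "(n choose 2) - \<delta> n \<le> real (kolmogorov U (graph_string n E) (string_of_nat n))"
        using that by (auto simp: random_graph_def)
      have "((n choose 2) - \<delta> n - c) * ln 2 \<le>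
          (real (kolmogorov U (graph_string n E) (string_of_nat n)) - c) * ln 2"
        using E ln2 by (intro mult_right_mono) auto
      also have "\<dots> \<le> (n choose 2) * ln 2 + ln 2 + 2 * ln n + 1 - n / real m ^ 2"
        using c[OF elim(3) E(1) that(2)] .
      finally have "n / real m ^ 2 \<le> (\<delta> n + c) * ln 2 + ln 2 + 2 * ln n + 1"
        by (simp add: algebra_simps)
      also have "(\<delta> n + c) * ln 2 \<le> (a * n + c) * 1"
        using elim(1) a ln2 by (intro mult_mono) auto
      finally have "n / real m ^ 2 \<le> a * n + c + 2 + 2 * ln n" using ln2 by simp
      moreover have "n / real m ^ 2 = a * n + a * n" by (simp add: a_def field_simps)
      ultimately show False using elim(2) by linarith
    qed
    then show ?case by blast
  qed
qed

lemma num_two_paths_commute: "num_two_paths n E i j = num_two_paths n E j i"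
  unfolding num_two_paths_def by (rule arg_cong[of _ _ card]) (auto simp: insert_commute)

lemma not_deviant_bound:
  assumes "\<not> deviant m n E" "m > 0" "n > 0" "i \<in> {1..n}" "j \<in> {1..n}" "i \<noteq> j"
  shows "\<bar>real (num_two_paths n E i j) - real n / 4\<bar> < real n / real m"
proof -
  have "\<bar>real (num_two_paths n E a b) - real n / 4\<bar> < real n / real m"
    if "a \<in> {1..n}" "b \<in> {1..n}" "a < b" for a b
  proof -
    have "\<not> deviates m n (num_two_paths n E a b)"
      using assms(1) that unfolding deviant_def by blast
    then show ?thesis using deviates_iff[OF assms(2,3)] by (simp add: not_le)
  qed
  then show ?thesis
    using assms(4-6) num_two_paths_commute[of n E i j]
    by (cases i j rule: linorder_cases) (metis, simp, metis)
qed

lemma graph_dist_le_two: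
  assumes "u = v \<or> num_two_paths n E u v > 0"
  shows "graph_dist E u v \<le> 2"
proof (cases "u = v")
  case True
  then have "graph_path E u [u] v" by (simp add: graph_path_def)
  then have "graph_dist E u v \<le> enat (length [u] - 1)"
    unfolding graph_dist_def by (intro INF_lower) simp
  then show ?thesis by (rule order_trans) (simp add: zero_enat_def[symmetric])
next
  case False
  then obtain k where "k \<noteq> u" "k \<noteq> v" "{u, k} \<in> E" "{k, v} \<in> E"
    using assms unfolding num_two_paths_def by (auto simp: card_gt_0_iff)
  then have "graph_path E u [u, k, v] v" using False by (auto simp: graph_path_def)
  then have "graph_dist E u v \<le> enat (length [u, k, v] - 1)"
    unfolding graph_dist_def by (intro INF_lower) simp
  moreover have "enat (length [u, k, v] - 1) = 2" unfolding numeral_eq_enat by simp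
  ultimately show ?thesis by simp
qed

lemma graph_dist_ge_two:
  assumes "u \<noteq> v" "{u, v} \<notin> E"
  shows "2 \<le> graph_dist E u v"
  unfolding graph_dist_def
proof (rule INF_greatest)
  fix p assume "p \<in> {p. graph_path E u p v}"
  then have p: "p \<noteq> []" "hd p = u" "last p = v" "successively (\<lambda>a b. {a, b} \<in> E) p"
    by (auto simp: graph_path_def)
  have "3 \<le> length p"
  proof (rule ccontr)
    assume "\<not> 3 \<le> length p"
    moreover have "length p \<noteq> 0" using p(1) by simp
    ultimately have "length p = 1 \<or> length p = 2" by linarith
    then show False using p assms by (auto simp: length_Suc_conv numeral_2_eq_2)
  qed
  then show "2 \<le> enat (length p - 1)" by (simp add: numeral_eq_enat)
qed

text \<open>
Common neighbours give the upper bound.  The lower bound needs a pair of nonadjacent nodes, which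
exists because in a complete graph \<open>a\<close> and \<open>b\<close> would have \<open>n - 2\<close> common neighbours.
\<close>

lemma graph_diameter_two:
  assumes "\<And>i j. i \<in> {1..n} \<Longrightarrow> j \<in> {1..n} \<Longrightarrow> i \<noteq> j \<Longrightarrow> 0 < num_two_paths n E i j"
    and "a \<in> {1..n}" "b \<in> {1..n}" "a \<noteq> b" "num_two_paths n E a b < n - 2"
  shows "graph_diameter n E = 2"
proof (rule antisym)
  show "graph_diameter n E \<le> 2"
    unfolding graph_diameter_def
  proof (intro SUP_least)
    fix u v assume "u \<in> {1..n}" "v \<in> {1..n}"
    then show "graph_dist E u v \<le> 2"
      using assms(1)[of u v] by (intro graph_dist_le_two[of u v n]) (cases "u = v"; simp)
  qed
  have "\<exists>u\<in>{1..n}. \<exists>v\<in>{1..n}. u \<noteq> v \<and> {u, v} \<notin> E"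
  proof (rule ccontr)
    assume "\<not> ?thesis"
    then have complete: "{u, v} \<in> E" if "u \<in> {1..n}" "v \<in> {1..n}" "u \<noteq> v" for u v
      using that by blast
    have "{k \<in> {1..n}. k \<noteq> a \<and> k \<noteq> b \<and> {a, k} \<in> E \<and> {k, b} \<in> E} = {1..n} - {a, b}"
      using complete[OF assms(2)] complete[OF _ assms(3)] by blast
    then have "num_two_paths n E a b = n - 2"
      using assms(2-4) by (simp add: num_two_paths_def card_Diff_subset)
    then show False using assms(5) by simp
  qed
  then obtain u v where uv: "u \<in> {1..n}" "v \<in> {1..n}" "u \<noteq> v" "{u, v} \<notin> E" by blast
  have "2 \<le> graph_dist E u v" using uv by (intro graph_dist_ge_two)
  also have "\<dots> \<le> (SUP v\<in>{1..n}. graph_dist E u v)" using uv by (intro SUP_upper)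
  also have "\<dots> \<le> graph_diameter n E" unfolding graph_diameter_def using uv by (intro SUP_upper)
  finally show "2 \<le> graph_diameter n E" .
qed

theorem lemma2p5:
  fixes T :: "nat \<Rightarrow> tm" and U :: tm and \<delta> :: "nat \<Rightarrow> real"
  assumes "universal_tm T U"
    and "\<And>n. \<delta> n \<ge> 0"
    and "\<delta> \<in> o(\<lambda>n. real n)"
  shows "(\<exists>\<epsilon> :: nat \<Rightarrow> real.
            (\<forall>n. \<epsilon> n \<ge> 0) \<and> \<epsilon> \<in> o(\<lambda>n. real n) \<and>
            (\<forall>n E i j. random_graph U (\<delta> n) n E \<longrightarrow> i \<in> {1..n} \<longrightarrow> j \<in> {1..n} \<longrightarrow> i \<noteq> j \<longrightarrow>
               \<bar>real (num_two_paths n E i j) - real n / 4\<bar> \<le> \<epsilon> n)) \<and>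
         (\<forall>\<^sub>F n in sequentially. \<forall>E. random_graph U (\<delta> n) n E \<longrightarrow> graph_diameter n E = 2)"
proof (intro conjI)
  define S where "S n = {\<bar>real (num_two_paths n E i j) - real n / 4\<bar> |E i j.
    random_graph U (\<delta> n) n E \<and> i \<in> {1..n} \<and> j \<in> {1..n} \<and> i \<noteq> j}" for n
  define \<epsilon> where "\<epsilon> n = Max (insert 0 (S n))" for n
  have fin: "finite (S n)" for n
  proof (rule finite_subset)
    show "S n \<subseteq> (\<lambda>(E, i, j). \<bar>real (num_two_paths n E i j) - real n / 4\<bar>) ` (Pow (Pow {1..n}) \<times> {1..n} \<times> {1..n})"
    proof
      fix y assume "y \<in> S n"
      then obtain E i j where "y = \<bar>real (num_two_paths n E i j) - real n / 4\<bar>"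
        "random_graph U (\<delta> n) n E" "i \<in> {1..n}" "j \<in> {1..n}"
        unfolding S_def by blast
      then show "y \<in> (\<lambda>(E, i, j). \<bar>real (num_two_paths n E i j) - real n / 4\<bar>) ` (Pow (Pow {1..n}) \<times> {1..n} \<times> {1..n})"
        by (intro image_eqI[of _ _ "(E, i, j)"]) (auto simp: random_graph_def labeled_graph_def)
    qed
  qed auto
  have "\<epsilon> \<in> o(\<lambda>n. real n)"
  proof (rule landau_o.smallI)
    fix c :: real assume c: "0 < c"
    obtain m where m: "inverse (real (Suc m)) < c" using reals_Archimedean[OF c] by blast
    \<comment> \<open>The tail bound requires \<open>M \<ge> 2\<close>.\<close>
    define M where "M = Suc (Suc m)"
    have M: "real n / real M \<le> c * real n" for n
    proof -
      have "inverse (real M) \<le> inverse (real (Suc m))" by (simp add: M_def)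
      then have "inverse (real M) * real n \<le> c * real n" using m by (intro mult_right_mono) auto
      then show ?thesis by (simp add: divide_inverse mult.commute)
    qed
    have "\<forall>\<^sub>F n in sequentially. \<forall>E. random_graph U (\<delta> n) n E \<longrightarrow> \<not> deviant M n E"
      by (rule eventually_not_deviant[OF assms(1) _ assms(3)]) (simp add: M_def)
    then show "\<forall>\<^sub>F n in sequentially. norm (\<epsilon> n) \<le> c * norm (real n)"
      using eventually_gt_at_top[of 0]
    proof eventually_elim
      case (elim n)
      have "y \<le> c * real n" if y: "y \<in> S n" for y
      proof -
        obtain E i j where "y = \<bar>real (num_two_paths n E i j) - real n / 4\<bar>"
          "random_graph U (\<delta> n) n E" "i \<in> {1..n}" "j \<in> {1..n}" "i \<noteq> j"
          using y unfolding S_def by blast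
        then show ?thesis
          using not_deviant_bound[of M n E i j] elim M[of n] by (simp add: M_def)
      qed
      then have "\<epsilon> n \<le> c * real n" using fin c by (simp add: \<epsilon>_def)
      moreover have "0 \<le> \<epsilon> n" using fin by (simp add: \<epsilon>_def)
      ultimately show ?case by simp
    qed
  qed
  moreover have "\<forall>n. \<epsilon> n \<ge> 0" using fin by (simp add: \<epsilon>_def)
  moreover have "\<bar>real (num_two_paths n E i j) - real n / 4\<bar> \<le> \<epsilon> n"
    if "random_graph U (\<delta> n) n E" "i \<in> {1..n}" "j \<in> {1..n}" "i \<noteq> j" for n E i j
    unfolding \<epsilon>_def by (rule Max_ge) (use fin that in \<open>auto simp: S_def\<close>)
  ultimately show "\<exists>\<epsilon> :: nat \<Rightarrow> real.
            (\<forall>n. \<epsilon> n \<ge> 0) \<and> \<epsilon> \<in> o(\<lambda>n. real n) \<and>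
            (\<forall>n E i j. random_graph U (\<delta> n) n E \<longrightarrow> i \<in> {1..n} \<longrightarrow> j \<in> {1..n} \<longrightarrow> i \<noteq> j \<longrightarrow>
               \<bar>real (num_two_paths n E i j) - real n / 4\<bar> \<le> \<epsilon> n)"
    by blast
next
  have "\<forall>\<^sub>F n in sequentially. \<forall>E. random_graph U (\<delta> n) n E \<longrightarrow> \<not> deviant 5 n E"
    by (rule eventually_not_deviant[OF assms(1) _ assms(3)]) simp
  then show "\<forall>\<^sub>F n in sequentially. \<forall>E. random_graph U (\<delta> n) n E \<longrightarrow> graph_diameter n E = 2"
    using eventually_ge_at_top[of 4]
  proof eventually_elim
    case (elim n)
    have "graph_diameter n E = 2" if "random_graph U (\<delta> n) n E" for E
    proof -
      have bound: "\<bar>real (num_two_paths n E i j) - real n / 4\<bar> < real n / 5"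
        if "i \<in> {1..n}" "j \<in> {1..n}" "i \<noteq> j" for i j
        using not_deviant_bound[of 5 n E i j] elim that \<open>random_graph U (\<delta> n) n E\<close> by simp
      have "0 < num_two_paths n E i j" if "i \<in> {1..n}" "j \<in> {1..n}" "i \<noteq> j" for i j
        using bound[OF that] by (cases "num_two_paths n E i j = 0") auto
      moreover have "num_two_paths n E 1 2 < n - 2"
      proof -
        let ?r = "num_two_paths n E 1 2"
        have "\<bar>real ?r - real n / 4\<bar> < real n / 5"
          by (rule bound) (use elim in auto)
        then have "real ?r < real n - 2" using elim by linarith
        then show ?thesis by linarith
      qed
      ultimately show ?thesis using elim by (intro graph_diameter_two[of n E 1 2]) auto
    qed
    then show ?case by blast
  qed
qed

end
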